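(* a) Let $0<p\le 1$ and let $\{\alpha_k:k\in\mathbb N\}$ be a subsequence of the positive integers such that $$\sup_{k\in\mathbb N}\rho(\alpha_k)<\infty .$$ Then the maximal operator $$\widetilde S^{*,\vartriangle}f:=\sup_{k\in\mathbb N}|S_{\alpha_k}f|$$ is bounded from the Hardy space $H_p$ to the space $L_p$. b) Let $0<p<1$ and let $\{\alpha_k:k\in\mathbb N\}$ be a subsequence of the positive integers satisfying $$\sup_{k\in\mathbb N}\rho(\alpha_k)=\infty .$$ Then there exists a martingale $f\in H_p$ such that $$\sup_{k\in\mathbb N}\|S_{\alpha_k}f\|_{weak-L_p}=\infty .$$
   Context: $\mathbb N_+$ is the set of positive integers, $\mathbb N=\mathbb N_+\cup\{0\}$. Fix a bounded sequence $m=(m_0,m_1,\dots)$ of integers $m_k\ge 2$. $G_m=\prod_{k\ge0}Z_{m_k}$, where $Z_{m_k}=\{0,\dots,m_k-1\}$ is the additive group modulo $m_k$, with the product of the discrete topologies; $\mu$ is the Haar measure with $\mu(G_m)=1$. $M_0:=1$, $M_{k+1}:=m_kM_k$; every $n\in\mathbb N$ is uniquely $n=\sum_{j\ge0}n_jM_j$ with $n_j\in Z_{m_j}$. For $n\in\mathbb N_+$: $\langle n\rangle:=\min\{j:n_j\ne0\}$, $|n|:=\max\{j:n_j\neq0\}$, $\rho(n):=|n|-\langle n\rangle$. $r_k(x):=\exp(2\pi i x_k/m_k)$, $\psi_n:=\prod_{k\ge0}r_k^{n_k}$ (Vilenkin system). $I_0(x):=G_m$, $I_n(x):=\{y: y_0=x_0,\dots,y_{n-1}=x_{n-1}\}$;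 $\mathcal F_n$ is the $\sigma$-algebra generated by $\{I_n(x):x\in G_m\}$. For $g\in L_1(G_m)$: $\widehat g(k):=\int g\overline{\psi_k}\,d\mu$, $S_ng:=\sum_{k=0}^{n-1}\widehat g(k)\psi_k$. A martingale is a sequence $f=(f^{(n)}:n\in\mathbb N)$ of integrable functions with $f^{(n)}$ $\mathcal F_n$-measurable and $S_{M_n}f^{(k)}=f^{(n)}$ for $n\le k$; $f^*:=\sup_n|f^{(n)}|$; $H_p$ is the set of martingales with $\|f\|_{H_p}:=\|f^*\|_p<\infty$, where $\|g\|_p:=(\int|g|^pd\mu)^{1/p}$. For a martingale, $\widehat f(i):=\lim_k\int f^{(k)}\overline{\psi_i}\,d\mu$ and $S_nf:=\sum_{k=0}^{n-1}\widehat f(k)\psi_k$. $\|g\|_{weak-L_p}:=\sup_{\lambda>0}\lambda\,\mu(|g|>\lambda)^{1/p}$. An operator $T$ is bounded from $H_p$ to $L_p$ if there is a constant $C$ with $\|Tf\|_p\le C\|f\|_{H_p}$ for all $f\in H_p$. *)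

theory Defs
  imports "HOL-Probability.Probability"
begin

section \<open>Vilenkin groups\<close>

text \<open>
  The group \<open>G\<^sub>m\<close> is the set of all sequences \<open>x\<close> with \<open>x k \<in> {0..<m k}\<close>, with coordinatewise
  addition modulo \<open>m k\<close> and the product of the discrete topologies.
\<close>

definition vilenkin_group :: "(nat \<Rightarrow> nat) \<Rightarrow> (nat \<Rightarrow> nat) set" where
  "vilenkin_group m = (\<Pi>\<^sub>E k\<in>UNIV. {0..<m k})"

definition vilenkin_add :: "(nat \<Rightarrow> nat) \<Rightarrow> (nat \<Rightarrow> nat) \<Rightarrow> (nat \<Rightarrow> nat) \<Rightarrow> nat \<Rightarrow> nat" where
  "vilenkin_add m x y = (\<lambda>k. (x k + y k) mod m k)"

definition vilenkin_topology :: "(nat \<Rightarrow> nat) \<Rightarrow> (nat \<Rightarrow> nat) topology" where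
  "vilenkin_topology m = product_topology (\<lambda>k. discrete_topology {0..<m k}) UNIV"

text \<open>
  The normalized Haar measure is the product of the uniform measures on the factors. The lemmas
  \<open>prob_space_haar\<close>, \<open>sets_haar\<close> and \<open>haar_translation\<close> below show that this
  is a translation invariant probability measure on the Borel sets of \<open>vilenkin_topology m\<close>.
\<close>

definition haar :: "(nat \<Rightarrow> nat) \<Rightarrow> (nat \<Rightarrow> nat) measure" where
  "haar m = PiM UNIV (\<lambda>k. uniform_count_measure {0..<m k})"

lemma prob_space_coordinate: "(2::nat) \<le> n \<Longrightarrow> prob_space (uniform_count_measure {0..<n})"
  by (rule prob_space_uniform_count_measure) auto

lemma prob_space_haar: "(\<And>k. 2 \<le> m k) \<Longrightarrow> prob_space (haar m)"
  unfolding haar_def by (intro prob_space_PiM prob_space_coordinate)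

lemma space_haar: "space (haar m) = vilenkin_group m"
  by (simp add: haar_def vilenkin_group_def space_PiM space_uniform_count_measure)

lemma sets_haar:
  "sets (haar m) = sigma_sets (vilenkin_group m) {U. openin (vilenkin_topology m) U}"
proof
  have sp: "(\<Pi>\<^sub>E k\<in>UNIV. space (uniform_count_measure {0..<m k})) = vilenkin_group m"
    by (simp add: vilenkin_group_def space_uniform_count_measure)
  have top: "topspace (vilenkin_topology m) = vilenkin_group m"
    by (simp add: vilenkin_topology_def vilenkin_group_def)
  have 1: "openin (vilenkin_topology m) {x \<in> vilenkin_group m. x i \<in> A}"
    if "A \<subseteq> {0..<m i}" for i A
  proof -
    have "continuous_map (vilenkin_topology m) (discrete_topology {0..<m i}) (\<lambda>x. x i)"
      unfolding vilenkin_topology_def by (rule continuous_map_product_projection) simp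
    from openin_continuous_map_preimage[OF this, of A] that show ?thesis by (simp add: top)
  qed
  show "sets (haar m) \<subseteq> sigma_sets (vilenkin_group m) {U. openin (vilenkin_topology m) U}"
    unfolding haar_def sets_PiM_single sp
    by (intro sigma_sets_mono') (use 1 in \<open>auto simp: sets_uniform_count_measure\<close>)
  show "sigma_sets (vilenkin_group m) {U. openin (vilenkin_topology m) U} \<subseteq> sets (haar m)"
    unfolding space_haar[symmetric]
  proof (rule sets.sigma_sets_subset, rule subsetI)
    fix U assume "U \<in> {U. openin (vilenkin_topology m) U}"
    then have U: "openin (vilenkin_topology m) U" by simp
    let ?cyl = "\<lambda>n x. {y \<in> vilenkin_group m. \<forall>i<n. y i = x i}"
    define C where "C = (\<Union>n. ?cyl n ` (\<Pi>\<^sub>E i\<in>{..<n}. {0..<m i}))"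
    have "countable C"
      unfolding C_def
      by (intro countable_UN[OF countableI_type] countable_finite finite_imageI finite_PiE) auto
    then have count: "countable {B \<in> C. B \<subseteq> U}" by (rule countable_subset[rotated]) auto
    have meas: "B \<in> sets (haar m)" if B: "B \<in> C" for B
    proof -
      obtain n x where nx: "B = ?cyl n x" "x \<in> (\<Pi>\<^sub>E i\<in>{..<n}. {0..<m i})" using B unfolding C_def by blast
      have single: "{y \<in> space (haar m). y i \<in> {x i}} \<in> sets (haar m)" if "i \<in> {..<n}" for i
        using nx(2) that unfolding haar_def
        by (intro sets_Collect_single')
          (auto simp: space_uniform_count_measure sets_uniform_count_measure)
      have "{y \<in> space (haar m). \<forall>i\<in>{..<n}. y i \<in> {x i}} \<in> sets (haar m)"
        by (rule sets.sets_Collect_finite_All[OF single finite_lessThan])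
      moreover have "{y \<in> space (haar m). \<forall>i\<in>{..<n}. y i \<in> {x i}} = B"
        unfolding nx(1) space_haar by blast
      ultimately show ?thesis by simp
    qed
    have "\<exists>B\<in>C. x \<in> B \<and> B \<subseteq> U" if x: "x \<in> U" for x
    proof -
      have "\<exists>W. finite {i \<in> UNIV. W i \<noteq> topspace (discrete_topology {0..<m i})} \<and>
          (\<forall>i\<in>UNIV. openin (discrete_topology {0..<m i}) (W i)) \<and>
          x \<in> Pi\<^sub>E UNIV W \<and> Pi\<^sub>E UNIV W \<subseteq> U"
        using U x unfolding vilenkin_topology_def openin_product_topology_alt by (rule bspec)
      then obtain W where W:
          "finite {i. W i \<noteq> {0..<m i}}" "x \<in> Pi\<^sub>E UNIV W" "Pi\<^sub>E UNIV W \<subseteq> U"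
        by (simp only: topspace_discrete_topology UNIV_I simp_thms) (elim exE conjE, rule that)
      obtain n where n: "\<And>i. W i \<noteq> {0..<m i} \<Longrightarrow> i < n"
        using finite_nat_bounded[OF W(1)] by (auto simp: subset_iff)
      have xG: "x \<in> vilenkin_group m" using openin_subset[OF U] x by (auto simp: top)
      define B where "B = ?cyl n (restrict x {..<n})"
      have BC: "B \<in> C"
        using xG unfolding C_def B_def
        by (intro UN_I[of n] imageI) (auto simp: vilenkin_group_def PiE_iff extensional_def)
      have xB: "x \<in> B" using xG by (simp add: B_def)
      have "B \<subseteq> Pi\<^sub>E UNIV W"
      proof
        fix y assume "y \<in> B"
        then have y: "y \<in> vilenkin_group m" "\<And>i. i < n \<Longrightarrow> y i = x i" by (simp_all add: B_def)
        have "y i \<in> W i" for i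
        proof (cases "i < n")
          case True then show ?thesis using y W(2) by auto
        next
          case False then have "W i = {0..<m i}" using n by blast
          then show ?thesis using y by (auto simp: vilenkin_group_def)
        qed
        then show "y \<in> Pi\<^sub>E UNIV W" by auto
      qed
      then have "B \<subseteq> U" using W(3) by (rule subset_trans)
      with xB show ?thesis by (intro bexI[OF _ BC] conjI)
    qed
    then have "U = \<Union>{B \<in> C. B \<subseteq> U}" by blast
    also have "\<dots> \<in> sets (haar m)"
      by (rule sets.countable_Union[OF count]) (use meas in blast)
    finally show "U \<in> sets (haar m)" .
  qed
qed

lemma haar_translation:
  assumes m: "\<And>k. 2 \<le> m k" and a: "a \<in> vilenkin_group m"
  shows "distr (haar m) (haar m) (vilenkin_add m a) = haar m"
proof -
  let ?M = "\<lambda>k. uniform_count_measure {0..<m k}"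
  interpret product_prob_space ?M UNIV
    by (intro product_prob_spaceI prob_space_coordinate m)
  let ?t = "\<lambda>k y. (a k + y) mod m k"
  have ak: "a k < m k" for k using a by (auto simp: vilenkin_group_def)
  have m0: "0 < m k" for k using m[of k] by simp
  have inj: "inj_on (?t k) {0..<m k}" for k
  proof (rule inj_onI)
    fix x y assume "x \<in> {0..<m k}" "y \<in> {0..<m k}" "?t k x = ?t k y"
    moreover have "?t k z = (if a k + z < m k then a k + z else a k + z - m k)"
      if "z < m k" for z
      using ak[of k] that by (auto simp: le_mod_geq)
    ultimately show "x = y" using ak[of k] by (auto split: if_splits)
  qed
  have bij: "bij_betw (?t k) {0..<m k} {0..<m k}" for k
    unfolding bij_betw_def using inj m0 by (intro conjI inj endo_inj_surj) auto
  have meas: "vilenkin_add m a \<in> measurable (PiM UNIV ?M) (PiM UNIV ?M)"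
  proof (rule measurable_PiM_single')
    fix k
    have "?t k \<in> measurable (?M k) (?M k)"
      by (rule measurableI)
        (auto simp: space_uniform_count_measure sets_uniform_count_measure m0)
    then have "(\<lambda>x. ?t k (x k)) \<in> measurable (PiM UNIV ?M) (?M k)"
      by (rule measurable_compose[OF measurable_component_singleton[OF UNIV_I]])
    then show "(\<lambda>x. vilenkin_add m a x k) \<in> measurable (PiM UNIV ?M) (?M k)"
      by (simp add: vilenkin_add_def add.commute)
  qed (auto simp: vilenkin_add_def space_PiM space_uniform_count_measure m0)
  have "distr (PiM UNIV ?M) (PiM UNIV ?M) (vilenkin_add m a) = PiM UNIV ?M"
  proof (rule PiM_eq)
    fix J :: "nat set" and F :: "nat \<Rightarrow> nat set"
    assume J: "finite J" "J \<subseteq> UNIV" and F: "\<And>j. j \<in> J \<Longrightarrow> F j \<in> sets (?M j)"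
    let ?F' = "\<lambda>j. {y \<in> {0..<m j}. ?t j y \<in> F j}"
    have "emeasure (distr (PiM UNIV ?M) (PiM UNIV ?M) (vilenkin_add m a)) (emb UNIV J (Pi\<^sub>E J F))
      = emeasure (PiM UNIV ?M) (vilenkin_add m a -` (emb UNIV J (Pi\<^sub>E J F)) \<inter> space (PiM UNIV ?M))"
      by (rule emeasure_distr[OF meas]) (rule sets_PiM_I[OF J], use F in blast)
    also have "vilenkin_add m a -` (emb UNIV J (Pi\<^sub>E J F)) \<inter> space (PiM UNIV ?M)
      = emb UNIV J (Pi\<^sub>E J ?F')"
      using m0 by (auto simp: prod_emb_def space_PiM space_uniform_count_measure vilenkin_add_def PiE_iff)
    also have "emeasure (PiM UNIV ?M) \<dots> = (\<Prod>j\<in>J. emeasure (?M j) (?F' j))"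
      by (rule emeasure_PiM_emb) (use J in \<open>auto simp: sets_uniform_count_measure\<close>)
    also have "\<dots> = (\<Prod>j\<in>J. emeasure (?M j) (F j))"
    proof (rule prod.cong)
      fix j assume "j \<in> J"
      then have Fj: "F j \<subseteq> {0..<m j}" using F by (auto simp: sets_uniform_count_measure)
      have im: "?t j ` {0..<m j} = {0..<m j}" using bij[of j] by (simp add: bij_betw_def)
      have "?t j ` ?F' j = F j"
      proof (rule equalityI)
        show "F j \<subseteq> ?t j ` ?F' j"
        proof
          fix z assume z: "z \<in> F j"
          then have "z \<in> ?t j ` {0..<m j}" using Fj im by blast
          then obtain y where "z = ?t j y" "y \<in> {0..<m j}" by (rule imageE)
          with z show "z \<in> ?t j ` ?F' j" by simp
        qed
      qed auto
      moreover have "card (?t j ` ?F' j) = card (?F' j)"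
        by (intro card_image inj_on_subset[OF inj]) auto
      ultimately show "emeasure (?M j) (?F' j) = emeasure (?M j) (F j)"
        using Fj by (subst (1 2) emeasure_uniform_count_measure) auto
    qed simp
    finally show "emeasure (distr (PiM UNIV ?M) (PiM UNIV ?M) (vilenkin_add m a))
      (emb UNIV J (Pi\<^sub>E J F)) = (\<Prod>j\<in>J. emeasure (?M j) (F j))" .
  qed simp
  then show ?thesis by (simp add: haar_def)
qed

section \<open>The generalized number system\<close>

primrec gen_power :: "(nat \<Rightarrow> nat) \<Rightarrow> nat \<Rightarrow> nat" where
  "gen_power m 0 = 1"
| "gen_power m (Suc k) = m k * gen_power m k"

text \<open>
  \<open>digit m n j\<close> is the \<open>j\<close>-th coefficient of the expansion of \<open>n\<close> with respect to the
  \<open>gen_power m j\<close>; see \<open>digit_expansion\<close> and \<open>digit_unique\<close>.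
\<close>

definition digit :: "(nat \<Rightarrow> nat) \<Rightarrow> nat \<Rightarrow> nat \<Rightarrow> nat" where
  "digit m n j = n div gen_power m j mod m j"

lemma digit_expansion_mod: "(\<Sum>j<N. digit m n j * gen_power m j) = n mod gen_power m N"
  by (induction N) (simp_all add: digit_def mult.commute[of "m _"] mod_mult2_eq)

lemma less_gen_power: "(\<And>k. 2 \<le> m k) \<Longrightarrow> N < gen_power m N"
proof (induction N)
  case (Suc N)
  have "Suc N < 2 * gen_power m N" using Suc by fastforce
  also have "\<dots> \<le> m N * gen_power m N" using Suc.prems[of N] by simp
  finally show ?case by simp
qed simp

lemma digit_expansion:
  assumes "\<And>k. 2 \<le> m k"
  shows "n = (\<Sum>j\<le>n. digit m n j * gen_power m j)"
  using less_gen_power[of m "Suc n"] assms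
  by (simp only: digit_expansion_mod flip: lessThan_Suc_atMost) simp

lemma digit_add_multiple: "0 < gen_power m j \<Longrightarrow> digit m (x + gen_power m (Suc j) * c) j = digit m x j"
proof -
  assume "0 < gen_power m j"
  moreover have "x + gen_power m (Suc j) * c = x + gen_power m j * (m j * c)"
    by (simp add: algebra_simps)
  ultimately show ?thesis by (simp only: digit_def div_mult_self2) simp
qed

lemma digit_unique:
  assumes m: "\<And>k. 2 \<le> m k" and "\<And>j. j < N \<Longrightarrow> d j < m j" and "j < N"
  shows "digit m (\<Sum>i<N. d i * gen_power m i) j = d j"
proof -
  have pos: "0 < gen_power m k" for k
    using less_gen_power[of m k] m by (metis gr_zeroI not_less_zero)
  have "(\<Sum>i<N. d i * gen_power m i) < gen_power m N \<and>
    (\<forall>j<N. digit m (\<Sum>i<N. d i * gen_power m i) j = d j)"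
    using assms(2)
  proof (induction N)
    case (Suc N)
    let ?s = "\<Sum>i<N. d i * gen_power m i"
    have IH: "?s < gen_power m N" "\<forall>j<N. digit m ?s j = d j" using Suc by auto
    have dN: "Suc (d N) \<le> m N" using Suc.prems[of N] by simp
    have "?s + d N * gen_power m N < Suc (d N) * gen_power m N" using IH(1) by simp
    also have "\<dots> \<le> m N * gen_power m N" using dN by (rule mult_le_mono1)
    finally have less: "(\<Sum>i<Suc N. d i * gen_power m i) < gen_power m (Suc N)" by simp
    have "digit m (?s + d N * gen_power m N) j = d j" if "j < Suc N" for j
    proof (cases "j = N")
      case True
      then show ?thesis using IH(1) dN pos[of N] by (simp add: digit_def)
    next
      case False
      with that have j: "j < N" by simp
      then have "gen_power m (Suc j) dvd gen_power m N"
      proof (induction N)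
        case (Suc N)
        then show ?case by (cases "j = N") auto
      qed simp
      then obtain c where "gen_power m N = gen_power m (Suc j) * c" by (rule dvdE)
      then have "?s + d N * gen_power m N = ?s + gen_power m (Suc j) * (d N * c)"
        by (simp add: ac_simps)
      then show ?thesis using digit_add_multiple[OF pos] IH(2) j by metis
    qed
    with less show ?case by simp
  qed simp
  with assms(3) show ?thesis by blast
qed

definition min_index :: "(nat \<Rightarrow> nat) \<Rightarrow> nat \<Rightarrow> nat" where
  "min_index m n = Min {j. digit m n j \<noteq> 0}"

definition max_index :: "(nat \<Rightarrow> nat) \<Rightarrow> nat \<Rightarrow> nat" where
  "max_index m n = Max {j. digit m n j \<noteq> 0}"

definition index_spread :: "(nat \<Rightarrow> nat) \<Rightarrow> nat \<Rightarrow> nat" where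
  "index_spread m n = max_index m n - min_index m n"

section \<open>Vilenkin--Fourier series\<close>

definition rademacher :: "(nat \<Rightarrow> nat) \<Rightarrow> nat \<Rightarrow> (nat \<Rightarrow> nat) \<Rightarrow> complex" where
  "rademacher m k x = exp (2 * of_real pi * \<i> * of_nat (x k) / of_nat (m k))"

text \<open>All factors of the infinite product with \<open>digit m n k = 0\<close> are equal to 1.\<close>

definition vilenkin :: "(nat \<Rightarrow> nat) \<Rightarrow> nat \<Rightarrow> (nat \<Rightarrow> nat) \<Rightarrow> complex" where
  "vilenkin m n x = (\<Prod>k | digit m n k \<noteq> 0. rademacher m k x ^ digit m n k)"

lemma finite_digits:
  assumes "\<And>k. 2 \<le> m k"
  shows "finite {j. digit m n j \<noteq> 0}"
proof (rule finite_subset)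
  show "{j. digit m n j \<noteq> 0} \<subseteq> {..n}"
  proof (rule subsetI, rule ccontr)
    fix j assume "j \<in> {j. digit m n j \<noteq> 0}" "j \<notin> {..n}"
    moreover have "j < gen_power m j" using less_gen_power assms by blast
    ultimately show False by (simp add: digit_def)
  qed
qed simp

definition fourier_coeff :: "(nat \<Rightarrow> nat) \<Rightarrow> ((nat \<Rightarrow> nat) \<Rightarrow> complex) \<Rightarrow> nat \<Rightarrow> complex" where
  "fourier_coeff m g k = (\<integral>x. g x * cnj (vilenkin m k x) \<partial>haar m)"

definition partial_sum ::
    "(nat \<Rightarrow> nat) \<Rightarrow> nat \<Rightarrow> ((nat \<Rightarrow> nat) \<Rightarrow> complex) \<Rightarrow> (nat \<Rightarrow> nat) \<Rightarrow> complex" where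
  "partial_sum m n g x = (\<Sum>k<n. fourier_coeff m g k * vilenkin m k x)"

section \<open>Martingales and their partial sums\<close>

definition cylinder :: "(nat \<Rightarrow> nat) \<Rightarrow> nat \<Rightarrow> (nat \<Rightarrow> nat) \<Rightarrow> (nat \<Rightarrow> nat) set" where
  "cylinder m n x = {y \<in> vilenkin_group m. \<forall>i<n. y i = x i}"

definition filtration :: "(nat \<Rightarrow> nat) \<Rightarrow> nat \<Rightarrow> (nat \<Rightarrow> nat) measure" where
  "filtration m n = sigma (vilenkin_group m) (cylinder m n ` vilenkin_group m)"

type_synonym fun_seq = "nat \<Rightarrow> (nat \<Rightarrow> nat) \<Rightarrow> complex"

definition vilenkin_martingale :: "(nat \<Rightarrow> nat) \<Rightarrow> fun_seq \<Rightarrow> bool" where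
  "vilenkin_martingale m f \<longleftrightarrow>
     (\<forall>n. integrable (haar m) (f n)) \<and>
     (\<forall>n. f n \<in> borel_measurable (filtration m n)) \<and>
     (\<forall>n k. n \<le> k \<longrightarrow> (\<forall>x\<in>vilenkin_group m. partial_sum m (gen_power m n) (f k) x = f n x))"

definition mart_coeff :: "(nat \<Rightarrow> nat) \<Rightarrow> fun_seq \<Rightarrow> nat \<Rightarrow> complex" where
  "mart_coeff m f i = lim (\<lambda>k. fourier_coeff m (f k) i)"

definition mart_partial_sum ::
    "(nat \<Rightarrow> nat) \<Rightarrow> nat \<Rightarrow> fun_seq \<Rightarrow> (nat \<Rightarrow> nat) \<Rightarrow> complex" where
  "mart_partial_sum m n f x = (\<Sum>k<n. mart_coeff m f k * vilenkin m k x)"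

section \<open>Lebesgue, weak Lebesgue and Hardy spaces\<close>

text \<open>
  Maximal functions may take the value \<open>\<infinity>\<close>, and for \<open>0 < p < 1\<close> the norms are only quasinorms,
  so all of these are formed in \<open>ennreal\<close>, on functions that stand for \<open>|g|\<close>.
  The power \<open>ennreal_powr x a\<close> is used only with \<open>0 < a\<close>.
\<close>

definition ennreal_powr :: "ennreal \<Rightarrow> real \<Rightarrow> ennreal" where
  "ennreal_powr x a = (if x = \<infinity> then \<infinity> else ennreal (enn2real x powr a))"

definition Lp_norm :: "'a measure \<Rightarrow> real \<Rightarrow> ('a \<Rightarrow> ennreal) \<Rightarrow> ennreal" where
  "Lp_norm M p g = ennreal_powr (\<integral>\<^sup>+x. ennreal_powr (g x) p \<partial>M) (1 / p)"

definition weak_Lp_norm :: "'a measure \<Rightarrow> real \<Rightarrow> ('a \<Rightarrow> ennreal) \<Rightarrow> ennreal" where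
  "weak_Lp_norm M p g =
     (SUP l\<in>{0<..}. ennreal l * ennreal_powr (emeasure M {x \<in> space M. ennreal l < g x}) (1 / p))"

definition mart_maximal :: "fun_seq \<Rightarrow> (nat \<Rightarrow> nat) \<Rightarrow> ennreal" where
  "mart_maximal f x = (SUP n. ennreal (cmod (f n x)))"

definition hardy_norm :: "(nat \<Rightarrow> nat) \<Rightarrow> real \<Rightarrow> fun_seq \<Rightarrow> ennreal" where
  "hardy_norm m p f = Lp_norm (haar m) p (mart_maximal f)"

definition hardy_space :: "(nat \<Rightarrow> nat) \<Rightarrow> real \<Rightarrow> fun_seq set" where
  "hardy_space m p = {f. vilenkin_martingale m f \<and> hardy_norm m p f < \<infinity>}"

text \<open>As above, \<open>T f\<close> stands for the modulus of the image of \<open>f\<close>.\<close>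

definition bounded_hardy_Lp ::
    "(nat \<Rightarrow> nat) \<Rightarrow> real \<Rightarrow> (fun_seq \<Rightarrow> (nat \<Rightarrow> nat) \<Rightarrow> ennreal) \<Rightarrow> bool" where
  "bounded_hardy_Lp m p T \<longleftrightarrow>
     (\<exists>C::real. \<forall>f\<in>hardy_space m p. Lp_norm (haar m) p (T f) \<le> ennreal C * hardy_norm m p f)"

definition restricted_maximal ::
    "(nat \<Rightarrow> nat) \<Rightarrow> (nat \<Rightarrow> nat) \<Rightarrow> fun_seq \<Rightarrow> (nat \<Rightarrow> nat) \<Rightarrow> ennreal" where
  "restricted_maximal m \<alpha> f x = (SUP k. ennreal (cmod (mart_partial_sum m (\<alpha> k) f x)))"

end

theory Submission
  imports Defs
begin

text \<open>
  Write \<open>s\<close> for \<open>min_index m n\<close>. Since \<open>gen_power m s\<close> divides \<open>n\<close>, the kernel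
  \<open>\<Sum>k<n. \<psi> k x * cnj (\<psi> k y)\<close> vanishes unless \<open>y\<close> lies in the cylinder of level \<open>s\<close> around \<open>x\<close>, and
  it is bounded by \<open>n\<close>.

  (a) If \<open>n < gen_power m (s + J)\<close>, the partial sum at \<open>x\<close> is therefore at most a constant times the
  maximum of \<open>|f (s + J)|\<close> over the cylinder of level \<open>s\<close> around \<open>x\<close>. Stopping at the first level \<open>s\<close> where
  this maximum exceeds \<open>l\<close>, each stopped cylinder contains a subcylinder of comparable measure on which
  the martingale maximal function exceeds \<open>l\<close>. So the distribution functions are comparable, and
  integrating over \<open>l\<close> gives the bound for every \<open>p > 0\<close>, without an atomic decomposition.

  (b) The counterexample is a lacunary sum of the atoms
  \<open>M t powr (1 / p - 1) * (D (M (t + 1)) - D (M t))\<close> with weights \<open>2 powr (- i / p)\<close>, where \<open>M\<close> is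
  \<open>gen_power m\<close>, \<open>D\<close> is the Dirichlet kernel, and \<open>t\<close> runs over the top indices of a sparse
  subsequence of the \<open>\<alpha> k\<close>. For \<open>n\<close> in this subsequence \<open>|D n| \<ge> M s\<close> on a cylinder of level \<open>s + 1\<close>,
  which contributes about \<open>(M t / M s) powr (1 / p - 1)\<close> to the weak norm of the partial sum; this
  beats both the weight and the earlier atoms once the spread \<open>t - s\<close> is large enough.
\<close>

section \<open>Roots of unity\<close>

text \<open>\<open>cos\<close> is 1 only at integer multiples of 2 pi, which would make
  \<open>q\<close> divide \<open>d\<close>.\<close>

lemma cis_root_neq_1:
  assumes "0 < \<bar>d\<bar>" "\<bar>d\<bar> < int q" shows "cis (2 * pi * d / q) \<noteq> 1"
proof
  assume "cis (2 * pi * d / q) = 1"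
  then have "cos (2 * pi * d / q) = 1" by (simp add: complex_eq_iff)
  then obtain n :: int where "2 * pi * d / q = real_of_int n * 2 * pi" unfolding cos_one_2pi_int by blast
  then have "real_of_int d = real_of_int (n * int q)" using assms by (simp add: field_simps)
  then have "d = n * int q" by linarith
  then have "int q dvd d" by simp
  with assms show False using zdvd_imp_le[of "int q" "\<bar>d\<bar>"] by simp
qed

lemma cis_root_power: "0 < q \<Longrightarrow> cis (2 * pi * of_int d / real q) ^ q = 1"
proof -
  assume "0 < q"
  then have "cis (2 * pi * of_int d / real q) ^ q = cis (2 * pi * of_int d)"
    by (simp only: Complex.DeMoivre) simp
  then show ?thesis by simp
qed

section \<open>Digits and generalized powers\<close>

locale vilenkin_system =
  fixes m :: "nat \<Rightarrow> nat"
  assumes m_ge: "2 \<le> m k"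
begin

abbreviation M :: "nat \<Rightarrow> nat" where "M \<equiv> gen_power m"
abbreviation G :: "(nat \<Rightarrow> nat) set" where "G \<equiv> vilenkin_group m"
abbreviation \<psi> :: "nat \<Rightarrow> (nat \<Rightarrow> nat) \<Rightarrow> complex" where "\<psi> \<equiv> vilenkin m"

sublocale prob_space "haar m"
  by (rule prob_space_haar) (rule m_ge)

lemma m_pos: "0 < m k"
  using m_ge[of k] by linarith

lemma gen_power_pos: "0 < M k"
  by (induction k) (simp_all add: m_pos)

lemma index_less_gen_power: "N < M N"
  by (rule less_gen_power) (rule m_ge)

lemma gen_power_Suc_ge: "2 * M k \<le> M (Suc k)"
  using m_ge[of k] by simp

lemma strict_mono_gen_power: "strict_mono M"
proof (rule strict_mono_Suc_iff[THEN iffD2], rule allI)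
  show "M k < M (Suc k)" for k using gen_power_Suc_ge[of k] gen_power_pos[of k] by linarith
qed

lemma gen_power_mono: "i \<le> j \<Longrightarrow> M i \<le> M j"
  using strict_mono_gen_power by (simp add: strict_mono_less_eq)

lemma gen_power_add_ge: "2 ^ r * M s \<le> M (s + r)"
proof (induction r)
  case (Suc r)
  have "2 ^ Suc r * M s \<le> 2 * M (s + r)" using Suc by simp
  also have "\<dots> \<le> M (s + Suc r)" using gen_power_Suc_ge[of "s + r"] by simp
  finally show ?case .
qed simp

lemma gen_power_dvd: "i \<le> j \<Longrightarrow> M i dvd M j"
  by (induction j) (auto simp: le_Suc_eq)

lemma digit_less: "digit m n j < m j"
  by (simp add: digit_def m_pos)

lemma digit_eq_0: "n < M N \<Longrightarrow> N \<le> j \<Longrightarrow> digit m n j = 0"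
  using gen_power_mono[of N j] by (simp add: digit_def)

lemma digit_0 [simp]: "digit m 0 j = 0"
  by (simp add: digit_def)

lemma finite_digit_support: "finite {j. digit m n j \<noteq> 0}"
  by (rule finite_digits) (rule m_ge)

lemma digit_support_nonempty: "0 < n \<Longrightarrow> {j. digit m n j \<noteq> 0} \<noteq> {}"
  using digit_expansion[of m n, OF m_ge] by force

text \<open>The summands occupy disjoint digit positions: the multiple of \<open>M s\<close> has no
  digits below \<open>s\<close>, and \<open>b < M s\<close> causes no carry into position
  \<open>s\<close> or beyond.\<close>

lemma digit_mult_add:
  assumes "b < M s"
  shows "digit m (a * M s + b) j = (if j < s then digit m b j else digit m (a * M s) j)"
proof (cases "j < s")
  case True
  then obtain c where "M s = M (Suc j) * c" using gen_power_dvd[of "Suc j" s] by (auto elim: dvdE)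
  then have "a * M s + b = b + M (Suc j) * (a * c)" by (simp only: ac_simps)
  then show ?thesis using True digit_add_multiple[OF gen_power_pos, of b j "a * c"] by (simp only: if_True)
next
  case False
  then obtain c where c: "M j = M s * c" using gen_power_dvd[of s j] by (auto elim: dvdE)
  have "(a * M s + b) div M j = (a * M s) div M j"
    using assms gen_power_pos[of s] by (simp add: c div_mult2_eq)
  then show ?thesis using False by (simp add: digit_def)
qed

lemma digit_mult_low: "j < s \<Longrightarrow> digit m (a * M s) j = 0"
  using digit_mult_add[of 0 s a j] gen_power_pos[of s] by simp

lemma digit_mult_at: "d < m s \<Longrightarrow> digit m (d * M s) j = (if j = s then d else 0)"
proof -
  assume d: "d < m s"
  then have "d * M s < M (Suc s)" using gen_power_pos[of s] by simp
  then have "s < j \<Longrightarrow> digit m (d * M s) j = 0" by (rule digit_eq_0) simp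
  moreover have "digit m (d * M s) s = d" using d gen_power_pos[of s] by (simp add: digit_def)
  ultimately show ?thesis using digit_mult_low[of j s d] by (cases j s rule: linorder_cases) auto
qed

text \<open>Digits beyond the top index vanish, so \<open>n\<close> equals its residue modulo the
  next generalized power. This covers \<open>n = 0\<close> too, whatever value \<open>Max {}\<close>
  has.\<close>

lemma less_gen_power_max_index: "n < M (Suc (max_index m n))"
proof -
  let ?t = "max_index m n"
  have high: "digit m n j = 0" if "?t < j" for j
    using that Max_ge[OF finite_digit_support, of j n] unfolding max_index_def by force
  define N where "N = Suc (n + ?t)"
  have "n < M N" using index_less_gen_power[of N] unfolding N_def by linarith
  then have "n = (\<Sum>j<N. digit m n j * M j)" by (simp add: digit_expansion_mod)
  also have "\<dots> = (\<Sum>j<Suc ?t. digit m n j * M j)"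
    by (rule sum.mono_neutral_right) (use high in \<open>auto simp: N_def\<close>)
  also have "\<dots> = n mod M (Suc ?t)" by (rule digit_expansion_mod)
  finally show ?thesis using gen_power_pos[of "Suc ?t"] mod_less_divisor by metis
qed

lemma gen_power_max_index_le:
  assumes "0 < n" shows "M (max_index m n) \<le> n"
proof -
  have "digit m n (max_index m n) \<noteq> 0"
    using Max_in[OF finite_digit_support digit_support_nonempty[OF assms]]
    unfolding max_index_def by simp
  then show ?thesis using digit_eq_0[of n "max_index m n"] by force
qed

lemma max_index_eq:
  assumes "M t \<le> n" "n < M (Suc t)" shows "max_index m n = t"
proof -
  have n: "0 < n" using assms gen_power_pos[of t] by simp
  have "M t < M (Suc (max_index m n))" using less_gen_power_max_index[of n] assms by linarith
  moreover have "M (max_index m n) < M (Suc t)" using gen_power_max_index_le[OF n] assms by linarith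
  ultimately show ?thesis
    unfolding strict_mono_less[OF strict_mono_gen_power] by linarith
qed

lemma digit_min_index_nz: "0 < n \<Longrightarrow> digit m n (min_index m n) \<noteq> 0"
  using Min_in[OF finite_digit_support digit_support_nonempty] unfolding min_index_def by auto

lemma gen_power_min_index_dvd: "M (min_index m n) dvd n"
proof -
  have "digit m n j = 0" if "j < min_index m n" for j
    using that Min_le[OF finite_digit_support, of j n] unfolding min_index_def by force
  then have "n mod M (min_index m n) = 0" by (simp flip: digit_expansion_mod)
  then show ?thesis by auto
qed

section \<open>Vilenkin functions\<close>

lemma vilenkin_eq_prod:
  assumes "n < M N" shows "\<psi> n x = (\<Prod>k<N. rademacher m k x ^ digit m n k)"
  unfolding vilenkin_def
proof (rule prod.mono_neutral_left)
  show "{k. digit m n k \<noteq> 0} \<subseteq> {..<N}"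
    using digit_eq_0[OF assms] by (metis (mono_tags) lessThan_iff mem_Collect_eq not_le subsetI)
qed auto

text \<open>In each coordinate at most one of the two numbers has a nonzero digit, so the exponents
  of the Rademacher functions add.\<close>

lemma vilenkin_mult_add:
  assumes "b < M s" shows "\<psi> (a * M s + b) x = \<psi> (a * M s) x * \<psi> b x"
proof -
  define N where "N = Suc (a * M s + b)"
  have N: "a * M s + b < M N" using index_less_gen_power[of N] unfolding N_def by linarith
  have "rademacher m k x ^ digit m (a * M s + b) k
      = rademacher m k x ^ digit m (a * M s) k * rademacher m k x ^ digit m b k" for k
    using digit_mult_low[of k s a] digit_eq_0[OF assms, of k] by (simp add: digit_mult_add[OF assms])
  then show ?thesis using N by (simp add: vilenkin_eq_prod[of _ N] prod.distrib)
qed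

lemma vilenkin_at:
  assumes "d < m s" shows "\<psi> (d * M s) x = rademacher m s x ^ d"
proof -
  have "d * M s < M (Suc s)" using assms gen_power_pos[of s] by simp
  moreover have "(\<Prod>k<s. rademacher m k x ^ digit m (d * M s) k) = 1"
    by (rule prod.neutral) (simp add: digit_mult_at[OF assms])
  ultimately show ?thesis
    by (simp only: vilenkin_eq_prod[of _ "Suc s"] prod.lessThan_Suc) (simp add: digit_mult_at[OF assms])
qed

lemma vilenkin_0 [simp]: "\<psi> 0 x = 1"
  by (simp add: vilenkin_def)

lemma norm_rademacher [simp]: "cmod (rademacher m k x) = 1"
proof -
  have "rademacher m k x = cis (2 * pi * x k / m k)"
    by (simp add: rademacher_def cis_conv_exp field_simps)
  then show ?thesis by simp
qed

lemma norm_vilenkin [simp]: "cmod (\<psi> n x) = 1"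
  by (simp add: vilenkin_def norm_power flip: prod_norm)

lemma vilenkin_cong: "n < M N \<Longrightarrow> (\<And>i. i < N \<Longrightarrow> x i = y i) \<Longrightarrow> \<psi> n x = \<psi> n y"
  by (auto simp: vilenkin_eq_prod rademacher_def intro!: prod.cong)

lemma vilenkin_zero [simp]: "\<psi> n (\<lambda>_. 0) = 1"
  by (simp add: vilenkin_def rademacher_def)

lemma zero_in_group [simp]: "(\<lambda>_. 0) \<in> G"
  by (auto simp: vilenkin_group_def m_pos)

lemma group_less: "x \<in> G \<Longrightarrow> x k < m k"
  by (auto simp: vilenkin_group_def)

section \<open>The kernel of the partial sums\<close>

text \<open>The Dirichlet kernel at the difference of \<open>x\<close> and \<open>y\<close>, kept in
  two arguments so that subtraction in the group is avoided.\<close>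

definition kernel :: "nat \<Rightarrow> (nat \<Rightarrow> nat) \<Rightarrow> (nat \<Rightarrow> nat) \<Rightarrow> complex" where
  "kernel n x y = (\<Sum>k<n. \<psi> k x * cnj (\<psi> k y))"

text \<open>The frequencies are cut into \<open>c\<close> blocks of length \<open>M s\<close>; at
  \<open>a * M s + b\<close> the function splits into a factor for the block and one for the
  position in it.\<close>

lemma kernel_mult:
  "kernel (c * M s) x y = (\<Sum>a<c. \<psi> (a * M s) x * cnj (\<psi> (a * M s) y)) * kernel (M s) x y"
proof -
  have "kernel (c * M s) x y = (\<Sum>a<c. \<Sum>k=a * M s..<a * M s + M s. \<psi> k x * cnj (\<psi> k y))"
    unfolding kernel_def by (rule sum.nat_group[symmetric])
  also have "\<dots> = (\<Sum>a<c. \<Sum>b<M s. \<psi> (a * M s) x * cnj (\<psi> (a * M s) y) * (\<psi> b x * cnj (\<psi> b y)))"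
  proof (rule sum.cong[OF refl])
    fix a
    have "(\<Sum>k=a * M s..<a * M s + M s. \<psi> k x * cnj (\<psi> k y))
        = (\<Sum>b<M s. \<psi> (a * M s + b) x * cnj (\<psi> (a * M s + b) y))"
      by (rule sum.reindex_bij_witness[of _ "\<lambda>b. a * M s + b" "\<lambda>k. k - a * M s"]) auto
    then show "(\<Sum>k=a * M s..<a * M s + M s. \<psi> k x * cnj (\<psi> k y))
        = (\<Sum>b<M s. \<psi> (a * M s) x * cnj (\<psi> (a * M s) y) * (\<psi> b x * cnj (\<psi> b y)))"
      by (simp add: vilenkin_mult_add mult.assoc mult.left_commute)
  qed
  also have "\<dots> = (\<Sum>a<c. \<psi> (a * M s) x * cnj (\<psi> (a * M s) y)) * kernel (M s) x y"
    by (simp only: kernel_def sum_product)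
  finally show ?thesis .
qed

lemma rademacher_quotient:
  "rademacher m k x * cnj (rademacher m k y) = cis (2 * pi * (real (x k) - real (y k)) / m k)"
proof -
  have "rademacher m k z = cis (2 * pi * z k / m k)" for z
    by (simp add: rademacher_def cis_conv_exp field_simps)
  then show ?thesis by (simp add: cis_cnj cis_mult diff_divide_distrib right_diff_distrib)
qed

text \<open>A full geometric sum of powers of an \<open>m k\<close>-th root of unity, which is 1
  exactly if the coordinates agree.\<close>

lemma sum_rademacher_quotient:
  assumes "x k < m k" "y k < m k"
  shows "(\<Sum>d<m k. (rademacher m k x * cnj (rademacher m k y)) ^ d) = (if x k = y k then of_nat (m k) else 0)"
proof (cases "x k = y k")
  case True
  then show ?thesis by (simp add: rademacher_quotient)
next
  case False
  have eq: "rademacher m k x * cnj (rademacher m k y) = cis (2 * pi * of_int (int (x k) - int (y k)) / m k)"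
    by (simp add: rademacher_quotient)
  moreover have "cis (2 * pi * of_int (int (x k) - int (y k)) / m k) \<noteq> 1"
    by (rule cis_root_neq_1) (use False assms in auto)
  moreover note cis_root_power[OF m_pos[of k], of "int (x k) - int (y k)"]
  ultimately show ?thesis using False by (simp only: sum_gp_strict) simp
qed

text \<open>Passing from \<open>s\<close> to \<open>Suc s\<close> multiplies the kernel by a full
  geometric sum in coordinate \<open>s\<close>, which tests whether \<open>x\<close> and
  \<open>y\<close> agree there.\<close>

lemma kernel_gen_power:
  assumes "x \<in> G" "y \<in> G"
  shows "kernel (M s) x y = (if \<forall>i<s. y i = x i then of_nat (M s) else 0)"
proof (induction s)
  case 0
  then show ?case by (simp add: kernel_def)
next
  case (Suc s)
  have "(\<Sum>a<m s. \<psi> (a * M s) x * cnj (\<psi> (a * M s) y)) = (if x s = y s then of_nat (m s) else 0)"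
    using sum_rademacher_quotient[of x s y] assms
    by (simp add: vilenkin_at power_mult_distrib group_less)
  then show ?case using Suc kernel_mult[of "m s" s x y] by (auto simp: less_Suc_eq)
qed

text \<open>With \<open>n = c * M s\<close> the kernel is a sum of \<open>c\<close> terms of modulus
  1 times the kernel for \<open>M s\<close>, which is \<open>M s\<close> on the cylinder and 0 off
  it.\<close>

lemma norm_kernel_le:
  assumes "x \<in> G" "y \<in> G" "M s dvd n"
  shows "cmod (kernel n x y) \<le> n * indicator (cylinder m s x) y"
proof -
  obtain c where n: "n = c * M s" using assms(3) by (metis dvdE mult.commute)
  have "cmod (\<Sum>a<c. \<psi> (a * M s) x * cnj (\<psi> (a * M s) y)) \<le> (\<Sum>a<c. 1)"
    by (rule sum_norm_le) (simp add: norm_mult)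
  then have "cmod (kernel n x y) \<le> c * cmod (kernel (M s) x y)"
    unfolding n kernel_mult norm_mult by (intro mult_right_mono) simp_all
  also have "\<dots> = n * indicator (cylinder m s x) y"
    using assms by (simp add: kernel_gen_power n indicator_def cylinder_def)
  finally show ?thesis .
qed

section \<open>Cylinders and functions constant on them\<close>

lemma cylinder_subset: "cylinder m n x \<subseteq> G"
  by (auto simp: cylinder_def)

lemma mem_cylinder_self: "x \<in> G \<Longrightarrow> x \<in> cylinder m n x"
  by (simp add: cylinder_def)

lemma mem_cylinder_group: "y \<in> cylinder m n x \<Longrightarrow> y \<in> G"
  by (simp add: cylinder_def)

lemma cylinder_eq: "y \<in> cylinder m n x \<Longrightarrow> cylinder m n y = cylinder m n x"
  by (auto simp: cylinder_def)

lemma cylinder_antimono: "k \<le> n \<Longrightarrow> cylinder m n x \<subseteq> cylinder m k x"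
  by (auto simp: cylinder_def)

lemma cylinder_eq_prod_emb:
  "x \<in> G \<Longrightarrow> cylinder m n x =
    prod_emb UNIV (\<lambda>k. uniform_count_measure {0..<m k}) {..<n} (\<Pi>\<^sub>E i\<in>{..<n}. {x i})"
  by (auto simp: cylinder_def prod_emb_def space_uniform_count_measure vilenkin_group_def PiE_iff)

lemma sets_cylinder [measurable]:
  assumes "x \<in> G" shows "cylinder m n x \<in> sets (haar m)"
  unfolding cylinder_eq_prod_emb[OF assms] haar_def
  by (rule sets_PiM_I) (auto simp: sets_uniform_count_measure group_less[OF assms])

lemma emeasure_cylinder:
  assumes "x \<in> G" shows "emeasure (haar m) (cylinder m n x) = ennreal (1 / M n)"
proof -
  have "emeasure (haar m) (cylinder m n x) =
      (\<Prod>i<n. emeasure (uniform_count_measure {0..<m i}) {x i})"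
    unfolding cylinder_eq_prod_emb[OF assms] haar_def
    by (rule emeasure_PiM_emb)
      (auto simp: sets_uniform_count_measure group_less[OF assms] intro: prob_space_coordinate m_ge)
  also have "\<dots> = (\<Prod>i<n. ennreal (1 / m i))"
    by (rule prod.cong) (simp_all add: emeasure_uniform_count_measure group_less[OF assms])
  also have "\<dots> = ennreal (1 / M n)"
    by (induction n) (simp_all add: field_simps flip: ennreal_mult)
  finally show ?thesis .
qed

lemma measure_cylinder: "x \<in> G \<Longrightarrow> measure (haar m) (cylinder m n x) = 1 / M n"
  by (simp add: measure_def emeasure_cylinder)

lemma finite_cylinders: "finite (cylinder m n ` G)"
proof -
  have "cylinder m n x = cylinder m n (restrict x {..<n})" for x
    by (auto simp: cylinder_def)
  moreover have "restrict x {..<n} \<in> (\<Pi>\<^sub>E i\<in>{..<n}. {0..<m i})" if "x \<in> G" for x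
    using group_less[OF that] by simp
  ultimately have "cylinder m n ` G \<subseteq> cylinder m n ` (\<Pi>\<^sub>E i\<in>{..<n}. {0..<m i})"
    by blast
  then show ?thesis by (rule finite_subset) (simp add: finite_PiE)
qed

text \<open>The pointwise form of measurability with respect to \<open>filtration m n\<close>, for
  values in an arbitrary type.\<close>

definition determined :: "nat \<Rightarrow> ((nat \<Rightarrow> nat) \<Rightarrow> 'b) \<Rightarrow> bool" where
  "determined n g \<longleftrightarrow> (\<forall>x\<in>G. \<forall>y\<in>cylinder m n x. g y = g x)"

lemma sets_filtration: "sets (filtration m n) = sigma_sets G (cylinder m n ` G)"
  unfolding filtration_def by (rule sets_measure_of) (auto simp: cylinder_def)

lemma space_filtration: "space (filtration m n) = G"
  unfolding filtration_def by (rule space_measure_of) (auto simp: cylinder_def)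

lemma sets_filtration_haar: "sets (filtration m n) \<subseteq> sets (haar m)"
  unfolding sets_filtration space_haar[symmetric]
  by (rule sets.sigma_sets_subset) (auto simp: space_haar sets_cylinder)

lemma determined_sets:
  assumes "determined n P" shows "{x \<in> G. P x} \<in> sets (filtration m n)"
proof -
  have eq: "{x \<in> G. P x} = \<Union>(cylinder m n ` {x \<in> G. P x})"
  proof (intro equalityI subsetI)
    fix y assume "y \<in> \<Union>(cylinder m n ` {x \<in> G. P x})"
    then obtain x where "x \<in> G" "P x" "y \<in> cylinder m n x" by blast
    then show "y \<in> {x \<in> G. P x}" using assms mem_cylinder_group by (auto simp: determined_def)
  qed (use mem_cylinder_self in auto)
  have "finite (cylinder m n ` {x \<in> G. P x})"
    by (rule finite_subset[OF _ finite_cylinders[of n]]) auto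
  moreover have "cylinder m n ` {x \<in> G. P x} \<subseteq> sets (filtration m n)"
    unfolding sets_filtration by auto
  ultimately show ?thesis by (subst eq) (rule sets.finite_Union)
qed

lemma determined_measurable:
  assumes "determined n g" "g \<in> G \<rightarrow> space N" shows "g \<in> measurable (filtration m n) N"
proof (rule measurableI)
  fix A
  have "determined n (\<lambda>x. g x \<in> A)" using assms(1) by (simp add: determined_def)
  moreover have "g -` A \<inter> space (filtration m n) = {x \<in> G. g x \<in> A}"
    by (auto simp: space_filtration)
  ultimately show "g -` A \<inter> space (filtration m n) \<in> sets (filtration m n)"
    by (simp add: determined_sets)
qed (use assms space_filtration in auto)

lemma determined_measurable_haar:
  assumes "determined n g" "g \<in> G \<rightarrow> space N" shows "g \<in> measurable (haar m) N"
  using determined_measurable[OF assms] sets_filtration_haar[of n]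
  by (auto simp: measurable_def space_filtration space_haar)

lemma determined_vilenkin: "k < M n \<Longrightarrow> determined n (\<psi> k)"
  by (auto simp: determined_def cylinder_def intro!: vilenkin_cong)

lemma measurable_vilenkin [measurable]: "\<psi> k \<in> borel_measurable (haar m)"
  using index_less_gen_power[of k] by (intro determined_measurable_haar determined_vilenkin) auto

lemma measurable_cnj_compose [measurable (raw)]:
  "f \<in> borel_measurable N \<Longrightarrow> (\<lambda>x. cnj (f x)) \<in> borel_measurable N"
  by (rule borel_measurable_continuous_on) (intro continuous_intros)

lemma integrable_vilenkin_mult:
  assumes "integrable (haar m) g" shows "integrable (haar m) (\<lambda>x. g x * cnj (\<psi> k x))"
  by (rule Bochner_Integration.integrable_bound[OF assms])
    (use borel_measurable_integrable[OF assms] in \<open>auto simp: norm_mult\<close>)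

section \<open>Orthonormality and Fourier coefficients\<close>

lemma vilenkin_translate:
  "\<psi> n (vilenkin_add m a x) = \<psi> n a * \<psi> n x"
proof -
  have "rademacher m k (vilenkin_add m a x) = rademacher m k a * rademacher m k x" for k
  proof -
    have r: "rademacher m k z = cis (2 * pi * z k / m k)" for z
      by (simp add: rademacher_def cis_conv_exp field_simps)
    \<comment> \<open>\<open>q\<close> counts the multiples of \<open>m k\<close> removed by the
      reduction; each of them is a full turn.\<close>
    define q where "q = (a k + x k) div m k"
    have "real ((a k + x k) mod m k) = real (a k) + real (x k) - real q * real (m k)"
    proof -
      have "a k + x k = q * m k + (a k + x k) mod m k" unfolding q_def by simp
      then have "real (a k + x k) = real (q * m k + (a k + x k) mod m k)" by (rule arg_cong)
      then show ?thesis by simp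
    qed
    then have "2 * pi * real ((a k + x k) mod m k) / m k
        = 2 * pi * a k / m k + 2 * pi * x k / m k - 2 * pi * real q"
      using m_pos[of k] by (simp add: add_divide_distrib diff_divide_distrib distrib_left right_diff_distrib)
    then show ?thesis
      by (simp add: r vilenkin_add_def cis_mult flip: cis_divide)
  qed
  then show ?thesis by (simp add: vilenkin_def power_mult_distrib prod.distrib)
qed

lemma digit_neq:
  assumes "i \<noteq> j" shows "\<exists>k. digit m i k \<noteq> digit m j k"
proof (rule ccontr)
  assume "\<nexists>k. digit m i k \<noteq> digit m j k"
  then have "(\<Sum>k<i+j+1. digit m i k * M k) = (\<Sum>k<i+j+1. digit m j k * M k)" by simp
  moreover have "n = (\<Sum>k<i+j+1. digit m n k * M k)" if "n \<le> i + j" for n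
    using index_less_gen_power[of "i+j+1"] that unfolding digit_expansion_mod
    by (intro mod_less[symmetric]) linarith
  from this[of i] this[of j] have
    "i = (\<Sum>k<i+j+1. digit m i k * M k)" "j = (\<Sum>k<i+j+1. digit m j k * M k)" by simp_all
  ultimately show False using assms by argo
qed

text \<open>Translation by a unit vector in a coordinate where the digits differ preserves the
  integral but multiplies it by a root of unity other than 1, so the integral is 0.\<close>

lemma orthonormal: "(\<integral>x. \<psi> i x * cnj (\<psi> j x) \<partial>haar m) = (if i = j then 1 else 0)"
proof (cases "i = j")
  case True
  have "\<psi> j x * cnj (\<psi> j x) = 1" for x
    by (simp add: complex_norm_square[symmetric])
  then show ?thesis using True by (simp add: prob_space)
next
  case False
  then obtain k where k: "digit m i k \<noteq> digit m j k" using digit_neq by blast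
  define a where "a = (\<lambda>l. if l = k then 1 else 0 :: nat)"
  define J where "J = (\<integral>x. \<psi> i x * cnj (\<psi> j x) \<partial>haar m)"
  have a: "a \<in> G" using m_ge[of k] m_pos by (auto simp: a_def vilenkin_group_def)
  have rad: "rademacher m l a = (if l = k then cis (2 * pi / m k) else 1)" for l
    by (simp add: rademacher_def a_def cis_conv_exp field_simps)
  have \<psi>a: "\<psi> n a = cis (2 * pi / m k) ^ digit m n k" for n
  proof -
    define N where "N = Suc (n + k)"
    have "n < M N" using index_less_gen_power[of N] by (simp only: N_def)
    then have "\<psi> n a = (\<Prod>l<N. if l = k then cis (2 * pi / m k) ^ digit m n l else 1)"
      unfolding vilenkin_eq_prod[OF \<open>n < M N\<close>] by (intro prod.cong) (simp_all add: rad)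
    then show ?thesis by (simp add: N_def)
  qed
  have quot: "\<psi> i a * cnj (\<psi> j a) = cis (2 * pi * (int (digit m i k) - int (digit m j k)) / m k)"
    by (simp add: \<psi>a Complex.DeMoivre cis_cnj cis_mult diff_divide_distrib right_diff_distrib mult.commute)
  have neq: "\<psi> i a * cnj (\<psi> j a) \<noteq> 1"
    unfolding quot by (rule cis_root_neq_1) (use k digit_less[of i k] digit_less[of j k] in auto)
  have meas: "vilenkin_add m a \<in> measurable (haar m) (haar m)"
    unfolding haar_def
  proof (rule measurable_PiM_single')
    fix l
    have "determined (Suc l) (\<lambda>x. vilenkin_add m a x l)"
      by (simp add: determined_def cylinder_def vilenkin_add_def)
    then show "(\<lambda>x. vilenkin_add m a x l) \<in> measurable
        (Pi\<^sub>M UNIV (\<lambda>k. uniform_count_measure {0..<m k})) (uniform_count_measure {0..<m l})"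
      unfolding haar_def[symmetric]
      by (rule determined_measurable_haar)
        (simp add: vilenkin_add_def space_uniform_count_measure m_pos)
  qed (auto simp: vilenkin_add_def space_PiM space_uniform_count_measure m_pos)
  have "J = (\<integral>x. \<psi> i x * cnj (\<psi> j x) \<partial>distr (haar m) (haar m) (vilenkin_add m a))"
    unfolding J_def by (subst haar_translation) (use m_ge a in auto)
  also have "\<dots> = (\<integral>x. \<psi> i (vilenkin_add m a x) * cnj (\<psi> j (vilenkin_add m a x)) \<partial>haar m)"
    by (rule integral_distr[OF meas]) measurable
  also have "\<dots> = (\<integral>x. (\<psi> i a * cnj (\<psi> j a)) * (\<psi> i x * cnj (\<psi> j x)) \<partial>haar m)"
    by (rule Bochner_Integration.integral_cong) (simp_all only: space_haar vilenkin_translate complex_cnj_mult mult_ac)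
  also have "\<dots> = (\<psi> i a * cnj (\<psi> j a)) * J" unfolding J_def by simp
  finally have "(\<psi> i a * cnj (\<psi> j a) - 1) * J = 0" by (simp add: algebra_simps)
  then have "J = 0" using neq by simp
  then show ?thesis using False unfolding J_def by simp
qed

lemma integrable_vilenkin: "integrable (haar m) (\<psi> k)"
  by (rule integrable_const_bound[where B = 1]) auto

lemma fourier_coeff_polynomial:
  "fourier_coeff m (\<lambda>x. \<Sum>j<n. c j * \<psi> j x) i = (if i < n then c i else 0)"
proof -
  have "fourier_coeff m (\<lambda>x. \<Sum>j<n. c j * \<psi> j x) i
      = (\<integral>x. (\<Sum>j<n. c j * (\<psi> j x * cnj (\<psi> i x))) \<partial>haar m)"
    by (simp add: fourier_coeff_def sum_distrib_right mult.assoc)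
  also have "\<dots> = (\<Sum>j<n. \<integral>x. c j * (\<psi> j x * cnj (\<psi> i x)) \<partial>haar m)"
    by (intro Bochner_Integration.integral_sum integrable_mult_right integrable_vilenkin_mult
        integrable_vilenkin)
  also have "\<dots> = (\<Sum>j<n. c j * (if j = i then 1 else 0))"
    by (simp only: integral_mult_right_zero orthonormal)
  finally show ?thesis by (simp add: if_distrib[of "(*) _"] cong: if_cong)
qed

lemma fourier_coeff_cong:
  "(\<And>x. x \<in> G \<Longrightarrow> f x = g x) \<Longrightarrow> fourier_coeff m f i = fourier_coeff m g i"
  unfolding fourier_coeff_def by (rule Bochner_Integration.integral_cong) (auto simp: space_haar)

section \<open>Local bounds for partial sums\<close>

lemma partial_sum_kernel:
  assumes "integrable (haar m) g"
  shows "partial_sum m n g x = (\<integral>y. g y * kernel n x y \<partial>haar m)"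
proof -
  have "(\<integral>y. g y * kernel n x y \<partial>haar m) = (\<integral>y. (\<Sum>k<n. \<psi> k x * (g y * cnj (\<psi> k y))) \<partial>haar m)"
    by (simp add: kernel_def sum_distrib_left mult.left_commute)
  also have "\<dots> = (\<Sum>k<n. \<integral>y. \<psi> k x * (g y * cnj (\<psi> k y)) \<partial>haar m)"
    by (intro Bochner_Integration.integral_sum integrable_mult_right integrable_vilenkin_mult assms)
  also have "\<dots> = partial_sum m n g x"
    unfolding integral_mult_right_zero partial_sum_def fourier_coeff_def
    by (intro sum.cong refl mult.commute)
  finally show ?thesis by simp
qed

text \<open>The kernel is at most \<open>n\<close> in modulus and lives on a cylinder of measure
  \<open>1 / M s\<close>, so only the values of \<open>g\<close> there enter.\<close>

lemma norm_partial_sum_le: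
  assumes g: "integrable (haar m) g" and x: "x \<in> G" and dvd: "M s dvd n"
    and bound: "\<And>y. y \<in> cylinder m s x \<Longrightarrow> cmod (g y) \<le> B"
  shows "cmod (partial_sum m n g x) \<le> n / M s * B"
proof -
  have int: "integrable (haar m) (\<lambda>y. g y * kernel n x y)"
  proof -
    have "(\<lambda>y. g y * kernel n x y) = (\<lambda>y. \<Sum>k<n. \<psi> k x * (g y * cnj (\<psi> k y)))"
      by (simp add: kernel_def sum_distrib_left mult.left_commute)
    then show ?thesis
      by (simp only:) (intro Bochner_Integration.integrable_sum integrable_mult_right integrable_vilenkin_mult g)
  qed
  have "cmod (partial_sum m n g x) \<le> (\<integral>y. cmod (g y * kernel n x y) \<partial>haar m)"
    unfolding partial_sum_kernel[OF g] by (rule integral_norm_bound)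
  also have "\<dots> \<le> (\<integral>y. n * B * indicator (cylinder m s x) y \<partial>haar m)"
  proof (rule integral_mono)
    show "integrable (haar m) (\<lambda>y. cmod (g y * kernel n x y))" using int by (rule integrable_norm)
    show "integrable (haar m) (\<lambda>y. n * B * indicator (cylinder m s x) y)"
      using sets_cylinder[OF x] emeasure_cylinder[OF x]
      by (intro integrable_mult_right integrable_real_indicator) simp_all
    fix y assume "y \<in> space (haar m)"
    then have y: "y \<in> G" by (simp add: space_haar)
    have "cmod (g y * kernel n x y) \<le> cmod (g y) * (n * indicator (cylinder m s x) y)"
      unfolding norm_mult by (intro mult_left_mono norm_kernel_le x y dvd) simp
    also have "\<dots> \<le> n * B * indicator (cylinder m s x) y"
      using bound[of y] by (auto simp: indicator_def mult.commute[of _ B] intro: mult_right_mono)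
    finally show "cmod (g y * kernel n x y) \<le> n * B * indicator (cylinder m s x) y" .
  qed
  also have "\<dots> = n / M s * B" using x sets_cylinder[OF x, of s]
    by (simp add: measure_cylinder space_haar Int_absorb2 cylinder_subset)
  finally show ?thesis .
qed

end

section \<open>Distribution functions and powers in \<open>ennreal\<close>\<close>

text \<open>Tonelli's theorem for the region below the graph: \<open>f x\<close>, finite or not, is
  the length of the set of levels from 0 up to \<open>f x\<close>.\<close>

lemma nn_integral_layer_cake:
  assumes "sigma_finite_measure N" and f[measurable]: "f \<in> borel_measurable N"
  shows "(\<integral>\<^sup>+x. f x \<partial>N) = (\<integral>\<^sup>+l. indicator {0..} l * emeasure N {x \<in> space N. ennreal l < f x} \<partial>lborel)"
proof -
  interpret sigma_finite_measure N by fact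
  interpret pair_sigma_finite N lborel by unfold_locales
  let ?h = "\<lambda>x l. indicator {l. 0 \<le> l \<and> ennreal l < f x} l :: ennreal"
  have "emeasure lborel {l. 0 \<le> l \<and> ennreal l < z} = z" for z
  proof (cases z)
    case (real r)
    then have "{l. 0 \<le> l \<and> ennreal l < z} = {0..<r}" by (auto simp: ennreal_less_iff)
    then show ?thesis using real by simp
  next
    case top
    then have "{l. 0 \<le> l \<and> ennreal l < z} = {0..}" by auto
    moreover have "(SUP n. emeasure lborel {0..real n}) = emeasure lborel (\<Union>n. {0..real n})"
      by (rule SUP_emeasure_incseq) (auto simp: incseq_def)
    moreover have "(\<Union>n. {0..real n}) = {0..}" by (auto intro: real_arch_simple)
    ultimately show ?thesis using top
      by (simp add: ennreal_SUP_of_nat_eq_top flip: ennreal_of_nat_eq_real_of_nat)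
  qed
  then have "(\<integral>\<^sup>+x. f x \<partial>N) = (\<integral>\<^sup>+x. (\<integral>\<^sup>+l. ?h x l \<partial>lborel) \<partial>N)" by simp
  also have "\<dots> = (\<integral>\<^sup>+l. (\<integral>\<^sup>+x. ?h x l \<partial>N) \<partial>lborel)"
    by (rule Fubini'[symmetric]) measurable
  also have "\<dots> = (\<integral>\<^sup>+l. indicator {0..} l * emeasure N {x \<in> space N. ennreal l < f x} \<partial>lborel)"
  proof (rule nn_integral_cong)
    fix l :: real
    have "(\<integral>\<^sup>+x. ?h x l \<partial>N) =
        (\<integral>\<^sup>+x. indicator {0..} l * indicator {x \<in> space N. ennreal l < f x} x \<partial>N)"
      by (rule nn_integral_cong) (auto simp: indicator_def)
    then show "(\<integral>\<^sup>+x. ?h x l \<partial>N) = indicator {0..} l * emeasure N {x \<in> space N. ennreal l < f x}"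
      by (simp add: nn_integral_cmult)
  qed
  finally show ?thesis .
qed

lemma nn_integral_le_of_distribution:
  assumes "sigma_finite_measure N" "f \<in> borel_measurable N" "g \<in> borel_measurable N"
    and "\<And>l. emeasure N {x \<in> space N. l < f x} \<le> K * emeasure N {x \<in> space N. l < g x}"
  shows "(\<integral>\<^sup>+x. f x \<partial>N) \<le> K * (\<integral>\<^sup>+x. g x \<partial>N)"
proof -
  interpret sigma_finite_measure N by fact
  have [measurable]: "(\<lambda>l. emeasure N {x \<in> space N. ennreal l < g x}) \<in> borel_measurable lborel"
    using assms(3) by measurable
  have "(\<integral>\<^sup>+x. f x \<partial>N) \<le>
      (\<integral>\<^sup>+l. K * (indicator {0..} l * emeasure N {x \<in> space N. ennreal l < g x}) \<partial>lborel)"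
    unfolding nn_integral_layer_cake[OF assms(1,2)]
    by (intro nn_integral_mono) (use assms(4) in \<open>auto simp: indicator_def\<close>)
  also have "\<dots> = K * (\<integral>\<^sup>+x. g x \<partial>N)"
    unfolding nn_integral_layer_cake[OF assms(1,3)] by (rule nn_integral_cmult) measurable
  finally show ?thesis .
qed

lemma ennreal_powr_mono: "0 < p \<Longrightarrow> x \<le> y \<Longrightarrow> ennreal_powr x p \<le> ennreal_powr y p"
  by (cases x; cases y) (auto simp: ennreal_powr_def top_unique intro!: ennreal_leI powr_mono2)

lemma ennreal_powr_inverse:
  assumes "0 < p" shows "ennreal_powr (ennreal_powr x p) (1 / p) = x"
  using assms by (cases x) (simp_all add: ennreal_powr_def powr_powr)

lemma ennreal_powr_inverse':
  assumes "0 < p" shows "ennreal_powr (ennreal_powr x (1 / p)) p = x"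
  using assms by (cases x) (simp_all add: ennreal_powr_def powr_powr)

text \<open>The powers \<open>p\<close> and \<open>1 / p\<close> are monotone and mutually inverse,
  also at infinity. This moves the exponent from a function to a level.\<close>

lemma ennreal_powr_le_iff: "0 < p \<Longrightarrow> ennreal_powr x p \<le> y \<longleftrightarrow> x \<le> ennreal_powr y (1 / p)"
  using ennreal_powr_mono[of p x "ennreal_powr y (1 / p)"] ennreal_powr_mono[of "1 / p" "ennreal_powr x p" y]
  by (auto simp: ennreal_powr_inverse ennreal_powr_inverse')

lemma ennreal_powr_cmult:
  assumes "0 < c" "0 < p"
  shows "ennreal_powr (ennreal c * x) p = ennreal (c powr p) * ennreal_powr x p"
  using assms by (cases x)
    (auto simp: ennreal_powr_def powr_mult ennreal_mult_top simp flip: ennreal_mult)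

lemma measurable_ennreal_powr [measurable]: "(\<lambda>x. ennreal_powr x p) \<in> borel_measurable borel"
  unfolding ennreal_powr_def by measurable

section \<open>A maximal function over cylinders and its distribution\<close>

context vilenkin_system
begin

lemma determined_finite_range:
  assumes "determined n g" shows "finite (g ` G)"
proof -
  have "g ` G \<subseteq> (\<lambda>C. g (SOME y. y \<in> C)) ` (cylinder m n ` G)"
  proof
    fix z assume "z \<in> g ` G"
    then obtain x where x: "x \<in> G" "z = g x" by blast
    then have "(SOME y. y \<in> cylinder m n x) \<in> cylinder m n x"
      using mem_cylinder_self someI by metis
    then have "z = g (SOME y. y \<in> cylinder m n x)" using assms x by (auto simp: determined_def)
    then show "z \<in> (\<lambda>C. g (SOME y. y \<in> C)) ` (cylinder m n ` G)" using x by blast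
  qed
  then show ?thesis by (rule finite_subset) (intro finite_imageI finite_cylinders)
qed

text \<open>\<open>E\<close> is a finite disjoint union of cylinders of level \<open>s\<close>, over
  which the local estimates are added up.\<close>

lemma emeasure_union_cylinders_le:
  assumes E: "E \<subseteq> G" "determined s (\<lambda>x. x \<in> E)" and B: "B \<in> sets (haar m)"
    and le: "\<And>x. x \<in> E \<Longrightarrow>
      emeasure (haar m) (cylinder m s x) \<le> K * emeasure (haar m) (cylinder m s x \<inter> B)"
  shows "emeasure (haar m) E \<le> K * emeasure (haar m) (E \<inter> B)"
proof -
  let ?C = "cylinder m s ` E"
  have fin: "finite ?C"
    using E(1) by (intro finite_subset[OF _ finite_cylinders[of s]] image_mono)
  have U: "(\<Union>C\<in>?C. C \<inter> D) = E \<inter> D" for D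
  proof -
    have "\<Union>?C = E"
    proof (intro equalityI subsetI)
      fix y assume "y \<in> \<Union>?C"
      then obtain x where "x \<in> E" "y \<in> cylinder m s x" by blast
      then show "y \<in> E" using E unfolding determined_def by blast
    qed (use E mem_cylinder_self in blast)
    then show ?thesis by blast
  qed
  have disj: "disjoint_family_on (\<lambda>C. C \<inter> D) ?C" for D
    unfolding disjoint_family_on_def
  proof (intro ballI impI)
    fix C C' assume C: "C \<in> ?C" "C' \<in> ?C" "C \<noteq> C'"
    have "C = cylinder m s z" "C' = cylinder m s z" if "z \<in> C" "z \<in> C'" for z
      using that C(1,2) cylinder_eq by blast+
    with C(3) show "C \<inter> D \<inter> (C' \<inter> D) = {}" by blast
  qed
  have meas: "C \<in> sets (haar m)" if "C \<in> ?C" for C using that E(1) sets_cylinder by auto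
  have sum: "(\<Sum>C\<in>?C. emeasure (haar m) (C \<inter> D)) = emeasure (haar m) (E \<inter> D)"
    if "D \<in> sets (haar m)" for D
    unfolding U[symmetric] using that meas by (intro sum_emeasure disj fin) auto
  have "emeasure (haar m) E = (\<Sum>C\<in>?C. emeasure (haar m) (C \<inter> G))"
    using sum[of G] E(1) sets.top[of "haar m"] by (simp add: space_haar Int_absorb2)
  also have "\<dots> \<le> (\<Sum>C\<in>?C. K * emeasure (haar m) (C \<inter> B))"
    by (rule sum_mono) (use le in \<open>auto simp: Int_absorb2 cylinder_subset\<close>)
  also have "\<dots> = K * emeasure (haar m) (E \<inter> B)"
    by (simp add: sum[OF B] flip: sum_distrib_left)
  finally show ?thesis .
qed

text \<open>Up to a constant this dominates the partial sums whose index has its lowest nonzero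
  digit at \<open>s\<close> and its top digit below \<open>s + J\<close>: they see only the cylinder
  of level \<open>s\<close> and resolve it no finer than level \<open>s + J\<close>.\<close>

definition spread_maximal :: "nat \<Rightarrow> (nat \<Rightarrow> (nat \<Rightarrow> nat) \<Rightarrow> ennreal) \<Rightarrow> (nat \<Rightarrow> nat) \<Rightarrow> ennreal" where
  "spread_maximal J h x = (SUP s. SUP y\<in>cylinder m s x. h (s + J) y)"

text \<open>For fixed \<open>s\<close> the inner supremum depends only on the cylinder of level
  \<open>s\<close> around \<open>x\<close>, so it is measurable whatever \<open>h\<close> is; the
  outer supremum is countable.\<close>

lemma spread_maximal_measurable:
  "spread_maximal J h \<in> borel_measurable (haar m)"
  unfolding spread_maximal_def
proof (rule borel_measurable_SUP)
  fix s
  have "determined s (\<lambda>x. SUP y\<in>cylinder m s x. h (s + J) y)"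
    unfolding determined_def
  proof (intro ballI)
    fix x y assume "y \<in> cylinder m s x"
    then have "cylinder m s y = cylinder m s x" by (rule cylinder_eq)
    then show "(SUP z\<in>cylinder m s y. h (s + J) z) = (SUP z\<in>cylinder m s x. h (s + J) z)"
      by (simp only:)
  qed
  then show "(\<lambda>x. SUP y\<in>cylinder m s x. h (s + J) y) \<in> borel_measurable (haar m)"
    by (rule determined_measurable_haar) simp
qed simp

lemma gen_power_add_le: "(\<And>k. m k \<le> L) \<Longrightarrow> M (s + J) \<le> L ^ J * M s"
proof (induction J)
  case (Suc J)
  have "M (s + Suc J) = m (s + J) * M (s + J)" by simp
  also have "\<dots> \<le> L * (L ^ J * M s)" by (intro mult_le_mono Suc.IH Suc.prems)
  finally show ?case by (simp only: power_Suc mult.assoc)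
qed simp

text \<open>A stopped cylinder of level \<open>s\<close> contains a point where
  \<open>h (s + J)\<close> exceeds \<open>l\<close>. By constancy the same holds on a whole cylinder
  of level \<open>s + J\<close>, which fills at least the fraction \<open>1 / L ^ J\<close> of the
  stopped one.\<close>

lemma emeasure_spread_maximal_le:
  assumes h: "\<And>n. determined n (h n)" and L: "\<And>k. m k \<le> L"
  shows "emeasure (haar m) {x \<in> space (haar m). l < spread_maximal J h x}
    \<le> of_nat (L ^ J) * emeasure (haar m) {x \<in> space (haar m). l < (SUP n. h n x)}"
proof -
  define B where "B = {x \<in> space (haar m). l < (SUP n. h n x)}"
  have hm: "h n \<in> borel_measurable (haar m)" for n
    by (rule determined_measurable_haar[OF h]) simp
  have B: "B \<in> sets (haar m)" unfolding B_def using hm by measurable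
  define A where "A s = {x \<in> G. \<exists>y\<in>cylinder m s x. l < h (s + J) y}" for s
  \<comment> \<open>\<open>disjointed\<close> keeps in \<open>E s\<close> the points for which
    \<open>s\<close> is the first level where \<open>l\<close> is exceeded.\<close>
  define E where "E = disjointed A"
  have E_alt: "E s = A s - (\<Union>r<s. A r)" for s by (simp add: E_def disjointed_def atLeast0LessThan)
  \<comment> \<open>Membership in \<open>A r\<close> depends only on the cylinder of level
    \<open>r\<close>, hence also on the finer one of level \<open>s\<close>, so removing the earlier
    levels leaves a union of cylinders of level \<open>s\<close>.\<close>
  have Adet: "y \<in> A r \<longleftrightarrow> x \<in> A r" if "x \<in> G" "y \<in> cylinder m s x" "r \<le> s" for x y r s
  proof -
    have "y \<in> cylinder m r x" using that cylinder_antimono by blast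
    then show ?thesis using that cylinder_eq[of y r x] mem_cylinder_group by (auto simp: A_def)
  qed
  have EG: "E s \<subseteq> G" for s by (auto simp: E_alt A_def)
  have Edet: "determined s (\<lambda>x. x \<in> E s)" for s
    unfolding determined_def E_alt using Adet by (auto simp: less_imp_le)
  have Emeas: "E s \<in> sets (haar m)" for s
    using determined_sets[OF Edet[of s]] sets_filtration_haar[of s] EG[of s]
    by (auto simp: Int_absorb1 Collect_conj_eq)
  have "emeasure (haar m) (E s) \<le> of_nat (L ^ J) * emeasure (haar m) (E s \<inter> B)" for s
  proof (rule emeasure_union_cylinders_le[OF EG Edet B])
    fix x assume "x \<in> E s"
    then have x: "x \<in> G" "x \<in> A s" by (auto simp: E_alt A_def)
    then obtain y where y: "y \<in> cylinder m s x" "l < h (s + J) y" by (auto simp: A_def)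
    have yG: "y \<in> G" using y mem_cylinder_group by blast
    have "cylinder m (s + J) y \<subseteq> cylinder m s x \<inter> B"
    proof
      fix z assume z: "z \<in> cylinder m (s + J) y"
      then have "h (s + J) z = h (s + J) y" using h yG by (auto simp: determined_def)
      moreover have "h (s + J) z \<le> (SUP n. h n z)" by (rule SUP_upper) simp
      ultimately have "l < (SUP n. h n z)" using y(2) by simp
      moreover have "z \<in> cylinder m s x"
        using z y(1) cylinder_antimono[of s "s + J" y] cylinder_eq by auto
      ultimately show "z \<in> cylinder m s x \<inter> B"
        using mem_cylinder_group by (auto simp: B_def space_haar)
    qed
    then have D: "emeasure (haar m) (cylinder m (s + J) y) \<le> emeasure (haar m) (cylinder m s x \<inter> B)"
      using B sets_cylinder[OF x(1)] by (intro emeasure_mono) auto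
    have "1 / real (M s) \<le> real (L ^ J) * (1 / M (s + J))"
    proof -
      have "real (M (s + J)) \<le> real (L ^ J * M s)"
        using gen_power_add_le[of L s J, OF L] by (rule of_nat_mono)
      then show ?thesis using gen_power_pos[of s] gen_power_pos[of "s + J"] by (simp add: field_simps)
    qed
    then have "emeasure (haar m) (cylinder m s x) \<le> of_nat (L ^ J) * emeasure (haar m) (cylinder m (s + J) y)"
      unfolding emeasure_cylinder[OF x(1)] emeasure_cylinder[OF yG] ennreal_of_nat_eq_real_of_nat
      by (subst ennreal_mult[symmetric]) (auto intro: ennreal_leI)
    also have "\<dots> \<le> of_nat (L ^ J) * emeasure (haar m) (cylinder m s x \<inter> B)"
      using D by (rule mult_left_mono) simp
    finally show "emeasure (haar m) (cylinder m s x)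
        \<le> of_nat (L ^ J) * emeasure (haar m) (cylinder m s x \<inter> B)" .
  qed
  then have "(\<Sum>s. emeasure (haar m) (E s)) \<le> (\<Sum>s. of_nat (L ^ J) * emeasure (haar m) (E s \<inter> B))"
    by (intro suminf_le) auto
  also have "\<dots> = of_nat (L ^ J) * (\<Sum>s. emeasure (haar m) (E s \<inter> B))"
    by (rule ennreal_suminf_cmult)
  also have "(\<Sum>s. emeasure (haar m) (E s \<inter> B)) = emeasure (haar m) (\<Union>s. E s \<inter> B)"
    using Emeas B disjoint_family_disjointed[of A]
    by (intro suminf_emeasure) (auto simp: disjoint_family_on_def E_def)
  also have "\<dots> \<le> emeasure (haar m) B" using B by (intro emeasure_mono) auto
  finally have "(\<Sum>s. emeasure (haar m) (E s)) \<le> of_nat (L ^ J) * emeasure (haar m) B"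
    by (simp add: mult_left_mono)
  moreover have "(\<Sum>s. emeasure (haar m) (E s)) = emeasure (haar m) (\<Union>s. E s)"
    using Emeas disjoint_family_disjointed[of A] by (intro suminf_emeasure) (auto simp: E_def)
  moreover have "{x \<in> space (haar m). l < spread_maximal J h x} = (\<Union>s. E s)"
    by (auto simp: E_def UN_disjointed_eq A_def spread_maximal_def less_SUP_iff space_haar)
  ultimately show ?thesis unfolding B_def by (simp only:)
qed

section \<open>Coefficients and partial sums of martingales\<close>

lemma martingale_partial_sum:
  assumes "vilenkin_martingale m f" "n \<le> k" "x \<in> G"
  shows "f n x = (\<Sum>j<M n. fourier_coeff m (f k) j * \<psi> j x)"
proof -
  have "partial_sum m (M n) (f k) x = f n x"
    using assms unfolding vilenkin_martingale_def by blast
  then show ?thesis by (simp only: partial_sum_def)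
qed

text \<open>The martingale identity with \<open>k = n\<close> writes \<open>f n\<close> as a sum of
  Vilenkin functions with index below \<open>M n\<close>, which depend only on the first
  \<open>n\<close> coordinates.\<close>

lemma martingale_determined:
  assumes "vilenkin_martingale m f" shows "determined n (f n)"
proof -
  have eq: "f n x = (\<Sum>k<M n. fourier_coeff m (f n) k * \<psi> k x)" if "x \<in> G" for x
    by (rule martingale_partial_sum[OF assms order_refl that])
  show ?thesis
    unfolding determined_def
  proof (intro ballI)
    fix x y assume xy: "x \<in> G" "y \<in> cylinder m n x"
    then have "\<psi> k y = \<psi> k x" if "k < M n" for k
      using determined_vilenkin[OF that] by (auto simp: determined_def)
    then show "f n y = f n x" using xy by (simp add: eq mem_cylinder_group)
  qed
qed

text \<open>The coefficient no longer changes from \<open>f n\<close> on, so the limit is that of an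
  eventually constant sequence.\<close>

lemma mart_coeff_eq:
  assumes f: "vilenkin_martingale m f" and "i < M n"
  shows "mart_coeff m f i = fourier_coeff m (f n) i"
proof -
  have "fourier_coeff m (f n) i = fourier_coeff m (f k) i" if "n \<le> k" for k
  proof -
    have "fourier_coeff m (f n) i
        = fourier_coeff m (\<lambda>x. \<Sum>j<M n. fourier_coeff m (f k) j * \<psi> j x) i"
      by (rule fourier_coeff_cong) (rule martingale_partial_sum[OF f that])
    then show ?thesis using assms(2) by (simp add: fourier_coeff_polynomial)
  qed
  then have "eventually (\<lambda>k. fourier_coeff m (f k) i = fourier_coeff m (f n) i) sequentially"
    unfolding eventually_sequentially by metis
  then show ?thesis unfolding mart_coeff_def by (intro limI tendsto_eventually)
qed

lemma mart_partial_sum_eq: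
  "vilenkin_martingale m f \<Longrightarrow> k \<le> M n \<Longrightarrow> mart_partial_sum m k f x = partial_sum m k (f n) x"
  by (auto simp: mart_partial_sum_def partial_sum_def mart_coeff_eq[of f _ n] intro!: sum.cong)

text \<open>With \<open>s = min_index m k\<close>, the strict bound on the spread gives
  \<open>k < M (s + J)\<close>. So \<open>f (s + J)\<close> carries all the coefficients involved,
  and the factor \<open>k / M s\<close> is at most \<open>L ^ J\<close>.\<close>

lemma norm_mart_partial_sum_le:
  assumes f: "vilenkin_martingale m f" and L: "\<And>k. m k \<le> L" and x: "x \<in> G"
    and k: "0 < k" "index_spread m k < J"
  shows "ennreal (cmod (mart_partial_sum m k f x))
    \<le> of_nat (L ^ J) * spread_maximal J (\<lambda>n x. ennreal (cmod (f n x))) x"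
proof -
  define s where "s = min_index m k"
  have "max_index m k < s + J" using k(2) unfolding s_def index_spread_def by linarith
  then have kM: "k < M (s + J)"
    using less_gen_power_max_index[of k] gen_power_mono[of "Suc (max_index m k)" "s + J"] by simp
  \<comment> \<open>\<open>f (s + J)\<close> takes finitely many values, so its modulus attains a
    maximum on the cylinder; the maximizing point \<open>y\<close> makes it a value that enters
    \<open>spread_maximal\<close>.\<close>
  define V where "V = (\<lambda>y. cmod (f (s + J) y)) ` cylinder m s x"
  have V: "\<exists>y\<in>cylinder m s x. v = cmod (f (s + J) y)" if "v \<in> V" for v
    using that unfolding V_def by blast
  have "determined (s + J) (\<lambda>y. cmod (f (s + J) y))"
    using martingale_determined[OF f, of "s + J"] by (auto simp: determined_def)
  then have "finite V" unfolding V_def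
    by (rule finite_subset[OF image_mono[OF cylinder_subset] determined_finite_range])
  moreover have "V \<noteq> {}" unfolding V_def using mem_cylinder_self[OF x] by blast
  ultimately obtain y where y: "y \<in> cylinder m s x" "Max V = cmod (f (s + J) y)"
    using V[OF Max_in] by blast
  have "cmod (mart_partial_sum m k f x) \<le> k / M s * Max V"
    unfolding mart_partial_sum_eq[OF f less_imp_le[OF kM]]
  proof (rule norm_partial_sum_le[OF _ x])
    show "integrable (haar m) (f (s + J))" using f by (simp add: vilenkin_martingale_def)
    show "M s dvd k" unfolding s_def by (rule gen_power_min_index_dvd)
    show "cmod (f (s + J) z) \<le> Max V" if "z \<in> cylinder m s x" for z
      using \<open>finite V\<close> that by (intro Max_ge) (auto simp: V_def)
  qed
  also have "\<dots> \<le> real (L ^ J) * Max V"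
  proof (rule mult_right_mono)
    have "k \<le> L ^ J * M s" using kM gen_power_add_le[of L s J, OF L] by linarith
    then have "real k \<le> real (L ^ J * M s)" by (rule of_nat_mono)
    then show "k / M s \<le> real (L ^ J)" using gen_power_pos[of s] by (simp add: field_simps)
  qed (simp add: y(2))
  finally have "ennreal (cmod (mart_partial_sum m k f x)) \<le> ennreal (real (L ^ J) * Max V)"
    by (rule ennreal_leI)
  also have "\<dots> = of_nat (L ^ J) * ennreal (cmod (f (s + J) y))"
    by (simp only: y(2) ennreal_mult ennreal_of_nat_eq_real_of_nat of_nat_0_le_iff norm_ge_zero)
  also have "\<dots> \<le> of_nat (L ^ J) * spread_maximal J (\<lambda>n x. ennreal (cmod (f n x))) x"
    unfolding spread_maximal_def by (intro mult_left_mono SUP_upper2[of s] SUP_upper2[OF y(1)]) auto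
  finally show ?thesis .
qed

lemma restricted_maximal_bounded:
  assumes p: "0 < p" and L: "\<And>k. m k \<le> L"
    and \<alpha>: "\<And>k. 0 < \<alpha> k" "\<And>k. index_spread m (\<alpha> k) < J"
  shows "bounded_hardy_Lp m p (restricted_maximal m \<alpha>)"
  unfolding bounded_hardy_Lp_def
proof (intro exI ballI)
  fix f assume "f \<in> hardy_space m p"
  then have f: "vilenkin_martingale m f" by (simp add: hardy_space_def)
  define h where "h = (\<lambda>n x. ennreal (cmod (f n x)))"
  define K where "K = real (L ^ J)"
  have K: "0 < K" using L[of 0] m_pos[of 0] by (simp add: K_def)
  have h: "determined n (h n)" for n
    using martingale_determined[OF f, of n] by (auto simp: determined_def h_def)
  have hm: "h n \<in> borel_measurable (haar m)" for n
    by (rule determined_measurable_haar[OF h]) simp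
  \<comment> \<open>A level set of a \<open>p\<close>-th power is a level set of the function
    itself, so the distribution bound applies at every level.\<close>
  have eq: "{x \<in> space (haar m). l < ennreal_powr (g x) p}
      = {x \<in> space (haar m). ennreal_powr l (1 / p) < g x}" for l g
    using ennreal_powr_le_iff[OF p] by (auto simp flip: not_le)
  have max: "mart_maximal f x = (SUP n. h n x)" for x by (simp add: mart_maximal_def h_def)
  note [measurable] = spread_maximal_measurable[of J h]
  have le: "(\<integral>\<^sup>+x. ennreal_powr (spread_maximal J h x) p \<partial>haar m)
      \<le> of_nat (L ^ J) * (\<integral>\<^sup>+x. ennreal_powr (mart_maximal f x) p \<partial>haar m)"
    unfolding max
  proof (rule nn_integral_le_of_distribution)
    show "sigma_finite_measure (haar m)" by unfold_locales
    show "(\<lambda>x. ennreal_powr (SUP n. h n x) p) \<in> borel_measurable (haar m)" using hm by measurable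
  qed (simp_all only: eq emeasure_spread_maximal_le[OF h L], measurable)
  have "(\<integral>\<^sup>+x. ennreal_powr (restricted_maximal m \<alpha> f x) p \<partial>haar m)
      \<le> (\<integral>\<^sup>+x. ennreal_powr (ennreal K * spread_maximal J h x) p \<partial>haar m)"
  proof (intro nn_integral_mono ennreal_powr_mono p)
    fix x assume "x \<in> space (haar m)"
    then show "restricted_maximal m \<alpha> f x \<le> ennreal K * spread_maximal J h x"
      unfolding restricted_maximal_def K_def h_def ennreal_of_nat_eq_real_of_nat[symmetric]
      by (intro SUP_least norm_mart_partial_sum_le[OF f L _ \<alpha>]) (simp add: space_haar)
  qed
  also have "\<dots> = ennreal (K powr p) * (\<integral>\<^sup>+x. ennreal_powr (spread_maximal J h x) p \<partial>haar m)"
    unfolding ennreal_powr_cmult[OF K p] by (rule nn_integral_cmult) measurable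
  \<comment> \<open>\<open>K powr p\<close> comes from the pointwise bound, the further factor
    \<open>K\<close> from the distribution functions.\<close>
  also have "\<dots> \<le> ennreal (K powr p) * (ennreal K * (\<integral>\<^sup>+x. ennreal_powr (mart_maximal f x) p \<partial>haar m))"
    using le by (intro mult_left_mono) (simp_all add: K_def ennreal_of_nat_eq_real_of_nat)
  also have "\<dots> = ennreal (K powr p * K) * (\<integral>\<^sup>+x. ennreal_powr (mart_maximal f x) p \<partial>haar m)"
    using K by (simp add: ennreal_mult mult.assoc)
  finally have "Lp_norm (haar m) p (restricted_maximal m \<alpha> f)
      \<le> ennreal_powr (ennreal (K powr p * K) * (\<integral>\<^sup>+x. ennreal_powr (mart_maximal f x) p \<partial>haar m)) (1 / p)"
    unfolding Lp_norm_def using p by (intro ennreal_powr_mono) simp_all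
  also have "\<dots> = ennreal ((K powr p * K) powr (1 / p)) * hardy_norm m p f"
    unfolding hardy_norm_def Lp_norm_def using p K by (intro ennreal_powr_cmult) simp_all
  finally show "Lp_norm (haar m) p (restricted_maximal m \<alpha> f)
      \<le> ennreal ((real (L ^ J) powr p * real (L ^ J)) powr (1 / p)) * hardy_norm m p f"
    unfolding K_def .
qed

end

section \<open>Elementary inequalities for the counterexample\<close>

lemma sum_lessThan_add:
  fixes f :: "nat \<Rightarrow> 'a::comm_monoid_add"
  shows "(\<Sum>k<a + b. f k) = (\<Sum>k<a. f k) + (\<Sum>k<b. f (a + k))"
  by (induction b) (simp_all add: add.assoc)

lemma norm_cis_minus_1: "(cmod (cis t - 1))\<^sup>2 = 2 - 2 * cos t"
proof -
  have "(cmod (cis t - 1))\<^sup>2 = (cos t - 1)\<^sup>2 + (sin t)\<^sup>2" by (simp add: cmod_power2)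
  also have "\<dots> = ((sin t)\<^sup>2 + (cos t)\<^sup>2) + 1 - 2 * cos t" by (simp add: power2_eq_square algebra_simps)
  finally show ?thesis by (simp only: sin_cos_squared_add)
qed

text \<open>Among the powers of \<open>cis (2 * pi / q)\<close> other than \<open>1\<close>, the first is one of the closest to \<open>1\<close>.\<close>

lemma norm_geometric_root_ge_1:
  assumes "0 < d" "d < q"
  shows "1 \<le> cmod (\<Sum>a<d. cis (2 * pi / real q) ^ a)"
proof -
  define t where "t = 2 * pi / real q"
  have t: "0 < t" "t * q = 2 * pi" using assms by (simp_all add: t_def)
  have td: "t \<le> d * t" using assms t by simp
  have "d + 1 \<le> q" using assms by simp
  then have "real (d + 1) * t \<le> real q * t" using t by (intro mult_right_mono) simp_all
  then have td2: "d * t \<le> 2 * pi - t" using t by (simp add: algebra_simps)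
  \<comment> \<open>The angle \<open>d * t\<close> lies between \<open>t\<close> and
    \<open>2 * pi - t\<close>, where \<open>cos\<close> is at most \<open>cos t\<close>; beyond
    \<open>pi\<close> this follows by reflection.\<close>
  have "cos (d * t) \<le> cos t"
  proof (cases "d * t \<le> pi")
    case True
    then show ?thesis using td t by (intro cos_monotone_0_pi_le) simp_all
  next
    case False
    then have "cos (2 * pi - d * t) \<le> cos t" using td2 t by (intro cos_monotone_0_pi_le) simp_all
    then show ?thesis by (simp add: cos_diff)
  qed
  then have "(cmod (cis t - 1))\<^sup>2 \<le> (cmod (cis (d * t) - 1))\<^sup>2"
    by (simp add: norm_cis_minus_1)
  then have le: "cmod (cis t - 1) \<le> cmod (cis (d * t) - 1)" by (rule power2_le_imp_le) simp
  have neq: "cis t \<noteq> 1" using cis_root_neq_1[of 1 q] assms by (simp add: t_def)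
  have "(\<Sum>a<d. cis t ^ a) = (1 - cis (d * t)) / (1 - cis t)"
    unfolding sum_gp_strict using neq by (simp add: Complex.DeMoivre)
  then have "cmod (\<Sum>a<d. cis t ^ a) = cmod (cis (d * t) - 1) / cmod (cis t - 1)"
    by (simp add: norm_divide norm_minus_commute)
  also have "1 \<le> \<dots>" using le neq by simp
  finally show ?thesis by (simp add: t_def)
qed

text \<open>After scaling by the sum both terms lie in the unit interval, where
  \<open>u \<le> u powr p\<close>.\<close>

lemma powr_add_le:
  assumes "0 \<le> x" "0 \<le> y" "0 < p" "p \<le> (1::real)"
  shows "(x + y) powr p \<le> x powr p + y powr p"
proof (cases "x + y = 0")
  case False
  define s where "s = x + y"
  have s: "0 < s" using False assms by (simp add: s_def)
  have "u / s \<le> (u / s) powr p" if "0 \<le> u" "u \<le> s" for u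
    using powr_mono'[of p 1 "u / s"] that s assms by simp
  from add_mono[OF this[of x] this[of y]] have "(x + y) / s \<le> (x / s) powr p + (y / s) powr p"
    using assms by (simp only: s_def add_divide_distrib)
  then have "s powr p * 1 \<le> s powr p * ((x / s) powr p + (y / s) powr p)"
    using s by (intro mult_left_mono) (simp_all add: s_def)
  also have "\<dots> = x powr p + y powr p"
    using s assms by (simp add: distrib_left flip: powr_mult)
  finally show ?thesis by (simp add: s_def)
qed (use assms in simp)

lemma powr_sum_le:
  assumes "\<And>i. i \<in> A \<Longrightarrow> 0 \<le> f i" "0 < p" "p \<le> (1::real)"
  shows "(\<Sum>i\<in>A. f i) powr p \<le> (\<Sum>i\<in>A. f i powr p)"
  using assms(1)
proof (induction A rule: infinite_finite_induct)
  case (insert a A)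
  have "(f a + (\<Sum>i\<in>A. f i)) powr p \<le> f a powr p + (\<Sum>i\<in>A. f i) powr p"
    using insert.prems assms by (intro powr_add_le sum_nonneg) auto
  then show ?case using insert by fastforce
qed simp_all

lemma weak_Lp_norm_ge:
  assumes g: "g \<in> borel_measurable N" and "A \<subseteq> space N" and "0 < l" "0 < p"
    and gt: "\<And>x. x \<in> A \<Longrightarrow> ennreal l < g x"
  shows "ennreal l * ennreal_powr (emeasure N A) (1 / p) \<le> weak_Lp_norm N p g"
proof -
  have "emeasure N A \<le> emeasure N {x \<in> space N. ennreal l < g x}"
    using assms by (intro emeasure_mono) auto
  then have "ennreal l * ennreal_powr (emeasure N A) (1 / p)
      \<le> ennreal l * ennreal_powr (emeasure N {x \<in> space N. ennreal l < g x}) (1 / p)"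
    using assms(4) by (intro mult_left_mono ennreal_powr_mono) simp_all
  also have "\<dots> \<le> weak_Lp_norm N p g"
    unfolding weak_Lp_norm_def using assms(3) by (intro SUP_upper) simp
  finally show ?thesis .
qed

section \<open>Martingales with prescribed coefficients and the Dirichlet kernel\<close>

context vilenkin_system
begin

definition series :: "(nat \<Rightarrow> complex) \<Rightarrow> fun_seq" where
  "series c n x = (\<Sum>j<M n. c j * \<psi> j x)"

lemma martingale_series: "vilenkin_martingale m (series c)"
  unfolding vilenkin_martingale_def
proof (intro conjI allI impI ballI)
  fix n
  have "determined n (series c n)"
    unfolding determined_def series_def
  proof (intro ballI sum.cong refl)
    fix x y j assume "x \<in> G" "y \<in> cylinder m n x" "j \<in> {..<M n}"
    then have "\<psi> j y = \<psi> j x" using determined_vilenkin[of j n] unfolding determined_def by blast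
    then show "c j * \<psi> j y = c j * \<psi> j x" by simp
  qed
  then show "series c n \<in> borel_measurable (filtration m n)"
    by (rule determined_measurable) simp
  show "integrable (haar m) (series c n)"
    unfolding series_def by (intro Bochner_Integration.integrable_sum integrable_mult_right integrable_vilenkin)
next
  fix n k :: nat and x assume "n \<le> k"
  then have "M n \<le> M k" by (rule gen_power_mono)
  then show "partial_sum m (M n) (series c k) x = series c n x"
    by (auto simp: partial_sum_def series_def[abs_def] fourier_coeff_polynomial intro!: sum.cong)
qed

lemma mart_partial_sum_series: "mart_partial_sum m n (series c) x = (\<Sum>j<n. c j * \<psi> j x)"
proof -
  have "mart_coeff m (series c) j = c j" for j
    using mart_coeff_eq[OF martingale_series index_less_gen_power, of c j]
    by (simp add: series_def[abs_def] fourier_coeff_polynomial index_less_gen_power)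
  then show ?thesis by (simp add: mart_partial_sum_def)
qed

definition dirichlet :: "nat \<Rightarrow> (nat \<Rightarrow> nat) \<Rightarrow> complex" where
  "dirichlet n x = (\<Sum>k<n. \<psi> k x)"

lemma dirichlet_gen_power:
  assumes "x \<in> G"
  shows "dirichlet (M s) x = (if x \<in> cylinder m s (\<lambda>_. 0) then of_nat (M s) else 0)"
proof -
  have "dirichlet (M s) x = kernel (M s) x (\<lambda>_. 0)" by (simp add: dirichlet_def kernel_def)
  then show ?thesis using assms by (auto simp: kernel_gen_power cylinder_def)
qed

text \<open>With \<open>d\<close> the lowest nonzero digit,
  \<open>n = c * M (Suc s) + d * M s\<close>. The first part contributes nothing because
  \<open>x s\<close> is not 0; the rest is a factor of modulus 1 times \<open>M s\<close> times a
  geometric sum of \<open>d\<close> terms, whose modulus is at least 1.\<close>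

lemma norm_dirichlet_ge:
  assumes x: "x \<in> cylinder m s (\<lambda>_. 0)" "x s = 1" and n: "0 < n" "s = min_index m n"
  shows "M s \<le> cmod (dirichlet n x)"
proof -
  have xG: "x \<in> G" using x(1) by (rule mem_cylinder_group)
  define c where "c = n div M s div m s"
  define d where "d = digit m n s"
  have d: "0 < d" "d < m s" using digit_min_index_nz[OF n(1)] digit_less n(2) by (simp_all add: d_def)
  have "n = (n div M s) * M s" using gen_power_min_index_dvd[of n] n(2) by simp
  also have "n div M s = c * m s + d" by (simp add: c_def d_def digit_def)
  finally have n_eq: "n = c * M (Suc s) + d * M s" by (simp add: algebra_simps)
  have "kernel (c * M (Suc s)) x (\<lambda>_. 0) = 0"
    unfolding kernel_mult kernel_gen_power[OF xG zero_in_group] using x(2) by auto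
  then have 1: "dirichlet (c * M (Suc s)) x = 0" by (simp add: dirichlet_def kernel_def)
  have "dirichlet n x = dirichlet (c * M (Suc s)) x + (\<Sum>b<d * M s. \<psi> (c * M (Suc s) + b) x)"
    unfolding n_eq dirichlet_def by (rule sum_lessThan_add)
  also have "(\<Sum>b<d * M s. \<psi> (c * M (Suc s) + b) x) = \<psi> (c * M (Suc s)) x * kernel (d * M s) x (\<lambda>_. 0)"
    unfolding kernel_def sum_distrib_left
  proof (rule sum.cong[OF refl])
    fix b assume "b \<in> {..<d * M s}"
    then have "b < d * M s" by simp
    also have "\<dots> \<le> M (Suc s)" using d by simp
    finally show "\<psi> (c * M (Suc s) + b) x = \<psi> (c * M (Suc s)) x * (\<psi> b x * cnj (\<psi> b (\<lambda>_. 0)))"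
      by (simp only: vilenkin_mult_add vilenkin_zero complex_cnj_one mult_1_right)
  qed
  also have "kernel (d * M s) x (\<lambda>_. 0) = (\<Sum>a<d. \<psi> (a * M s) x) * of_nat (M s)"
    unfolding kernel_mult kernel_gen_power[OF xG zero_in_group] using x(1) by (simp add: cylinder_def)
  also have "(\<Sum>a<d. \<psi> (a * M s) x) = (\<Sum>a<d. cis (2 * pi / m s) ^ a)"
  proof (rule sum.cong[OF refl])
    fix a assume "a \<in> {..<d}"
    moreover have "rademacher m s x = cis (2 * pi / m s)"
      using x(2) by (simp add: rademacher_def cis_conv_exp field_simps)
    ultimately show "\<psi> (a * M s) x = cis (2 * pi / m s) ^ a" using d by (simp add: vilenkin_at)
  qed
  finally have "cmod (dirichlet n x) = cmod (\<Sum>a<d. cis (2 * pi / m s) ^ a) * M s"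
    by (simp only: 1 add_0_left norm_mult norm_vilenkin norm_of_nat mult_1_left)
  moreover have "1 * real (M s) \<le> cmod (\<Sum>a<d. cis (2 * pi / m s) ^ a) * M s"
    using norm_geometric_root_ge_1[OF d] by (intro mult_right_mono) simp_all
  ultimately show ?thesis by (simp only: mult_1_left)
qed

text \<open>The value at \<open>j = 0\<close> is separate since \<open>max_index m 0\<close> is the maximum of an empty set.\<close>

definition block_coeff :: "(nat \<Rightarrow> real) \<Rightarrow> nat \<Rightarrow> complex" where
  "block_coeff b j = (if j = 0 then 0 else of_real (b (max_index m j)))"

text \<open>Frequencies from \<open>M t\<close> up to but excluding \<open>M (Suc t)\<close> have
  top index \<open>t\<close> and so share one coefficient.\<close>

lemma sum_block:
  fixes b :: "nat \<Rightarrow> real"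
  assumes "M t \<le> n" "n \<le> M (Suc t)"
  shows "(\<Sum>j<n. block_coeff b j * \<psi> j x)
    = (\<Sum>j<M t. block_coeff b j * \<psi> j x) + b t * (dirichlet n x - dirichlet (M t) x)"
proof -
  have split: "(\<Sum>j<n. g j) = (\<Sum>j<M t. g j) + (\<Sum>j=M t..<n. g j)" for g :: "nat \<Rightarrow> complex"
    using assms(1) by (simp add: lessThan_atLeast0 sum.atLeastLessThan_concat)
  have "(\<Sum>j=M t..<n. block_coeff b j * \<psi> j x) = (\<Sum>j=M t..<n. b t * \<psi> j x)"
  proof (rule sum.cong[OF refl])
    fix j assume j: "j \<in> {M t..<n}"
    then have "max_index m j = t" using assms by (intro max_index_eq) auto
    moreover have "j \<noteq> 0" using j gen_power_pos[of t] by auto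
    ultimately show "block_coeff b j * \<psi> j x = b t * \<psi> j x" by (simp add: block_coeff_def)
  qed
  then show ?thesis unfolding dirichlet_def split[of "\<lambda>j. block_coeff b j * \<psi> j x"] split[of "\<lambda>j. \<psi> j x"]
    by (simp add: sum_distrib_left)
qed

text \<open>Block \<open>u\<close> is \<open>b u\<close> times a difference of two Dirichlet
  kernels, which vanishes off the cylinder of level \<open>u\<close> around 0 and is at most
  \<open>M (Suc u)\<close> on it.\<close>

lemma norm_sum_blocks_le:
  fixes b :: "nat \<Rightarrow> real"
  assumes b: "\<And>u. 0 \<le> b u" and x: "x \<in> G"
  shows "cmod (\<Sum>j<M t. block_coeff b j * \<psi> j x)
    \<le> (\<Sum>u<t. b u * M (Suc u) * indicator (cylinder m u (\<lambda>_. 0)) x)"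
proof (induction t)
  case 0
  show ?case by (simp add: block_coeff_def)
next
  case (Suc t)
  let ?D = "dirichlet (M (Suc t)) x - dirichlet (M t) x"
  have "cmod ?D \<le> real (M (Suc t)) * indicator (cylinder m t (\<lambda>_. 0)) x"
  proof -
    have "x \<in> cylinder m (Suc t) (\<lambda>_. 0) \<Longrightarrow> x \<in> cylinder m t (\<lambda>_. 0)"
      by (simp add: cylinder_def)
    moreover have "real (M t) \<le> real (M (Suc t))" by (intro of_nat_mono gen_power_mono) simp
    moreover have "cmod (of_nat (M (Suc t)) - of_nat (M t)) = \<bar>real (M (Suc t)) - real (M t)\<bar>"
      by (metis norm_of_real of_real_diff of_real_of_nat_eq)
    ultimately show ?thesis
      unfolding dirichlet_gen_power[OF x] by (simp del: gen_power.simps add: indicator_def)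
  qed
  then have "cmod (b t * ?D) \<le> b t * (real (M (Suc t)) * indicator (cylinder m t (\<lambda>_. 0)) x)"
    unfolding norm_mult using b[of t] by (intro mult_mono) simp_all
  moreover have "(\<Sum>j<M (Suc t). block_coeff b j * \<psi> j x)
      = (\<Sum>j<M t. block_coeff b j * \<psi> j x) + b t * ?D"
    by (intro sum_block gen_power_mono) simp_all
  ultimately show ?case
    using Suc norm_triangle_ineq[of "\<Sum>j<M t. block_coeff b j * \<psi> j x" "b t * ?D"]
    by (simp only: sum.lessThan_Suc mult.assoc)
qed

section \<open>Hardy norm and weak norm of block series\<close>

text \<open>Subadditivity of the \<open>p\<close>-th power bounds the power of the maximal function
  by \<open>W\<close>, independently of \<open>n\<close>. The integral of \<open>W\<close> is the
  given series, as the cylinder of level \<open>u\<close> has measure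
  \<open>1 / M u\<close>.\<close>

lemma series_in_hardy_space:
  fixes b :: "nat \<Rightarrow> real"
  assumes b: "\<And>u. 0 \<le> b u" and p: "0 < p" "p \<le> 1"
    and summable: "summable (\<lambda>u. (b u * M (Suc u)) powr p / M u)"
  shows "series (block_coeff b) \<in> hardy_space m p"
proof -
  let ?f = "series (block_coeff b)"
  define w where "w u = (b u * M (Suc u)) powr p" for u
  define W where "W x = (\<Sum>u. ennreal (w u) * indicator (cylinder m u (\<lambda>_. 0)) x)" for x
  have "ennreal_powr (mart_maximal ?f x) p \<le> W x" if x: "x \<in> G" for x
  proof -
    have "ennreal_powr (ennreal (cmod (?f n x))) p \<le> W x" for n
    proof -
      have "cmod (?f n x) powr p \<le>
          (\<Sum>u<n. b u * M (Suc u) * indicator (cylinder m u (\<lambda>_. 0)) x) powr p"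
        unfolding series_def using p by (intro powr_mono2 norm_sum_blocks_le b x) simp_all
      also have "\<dots> \<le> (\<Sum>u<n. (b u * M (Suc u) * indicator (cylinder m u (\<lambda>_. 0)) x) powr p)"
        using p b by (intro powr_sum_le mult_nonneg_nonneg) (simp_all del: gen_power.simps)
      also have "\<dots> = (\<Sum>u<n. w u * indicator (cylinder m u (\<lambda>_. 0)) x)"
        by (intro sum.cong) (simp_all add: w_def indicator_def)
      finally have "ennreal (cmod (?f n x) powr p)
          \<le> ennreal (\<Sum>u<n. w u * indicator (cylinder m u (\<lambda>_. 0)) x)"
        by (rule ennreal_leI)
      also have "\<dots> = (\<Sum>u<n. ennreal (w u) * indicator (cylinder m u (\<lambda>_. 0)) x)"
        by (subst sum_ennreal[symmetric]) (auto simp: w_def indicator_def intro!: sum.cong)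
      also have "\<dots> \<le> W x" unfolding W_def by (intro sum_le_suminf) auto
      finally show ?thesis by (simp add: ennreal_powr_def)
    qed
    then show ?thesis
      unfolding ennreal_powr_le_iff[OF p(1)] mart_maximal_def by (intro SUP_least)
  qed
  then have "(\<integral>\<^sup>+x. ennreal_powr (mart_maximal ?f x) p \<partial>haar m) \<le> (\<integral>\<^sup>+x. W x \<partial>haar m)"
    by (intro nn_integral_mono) (simp add: space_haar)
  also have "\<dots> = (\<Sum>u. ennreal (w u / M u))"
    unfolding W_def
  proof (subst nn_integral_suminf)
    show "(\<lambda>x. ennreal (w u) * indicator (cylinder m u (\<lambda>_. 0)) x) \<in> borel_measurable (haar m)" for u
      using sets_cylinder[OF zero_in_group] by measurable
    have "(\<integral>\<^sup>+x. ennreal (w u) * indicator (cylinder m u (\<lambda>_. 0)) x \<partial>haar m) = ennreal (w u / M u)" for u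
      using sets_cylinder[OF zero_in_group, of u]
      by (simp add: nn_integral_cmult_indicator emeasure_cylinder w_def flip: ennreal_mult)
    then show "(\<Sum>u. \<integral>\<^sup>+x. ennreal (w u) * indicator (cylinder m u (\<lambda>_. 0)) x \<partial>haar m)
        = (\<Sum>u. ennreal (w u / M u))" by simp
  qed
  also have "\<dots> < \<infinity>"
    unfolding infinity_ennreal_def less_top[symmetric]
    by (rule ennreal_suminf_neq_top) (use summable in \<open>simp_all add: w_def\<close>)
  finally have "hardy_norm m p ?f < \<infinity>"
    unfolding hardy_norm_def Lp_norm_def by (simp add: ennreal_powr_def)
  then show ?thesis using martingale_series by (simp add: hardy_space_def)
qed

text \<open>On the cylinder of points that vanish below \<open>s\<close> and are 1 at
  \<open>s\<close>, \<open>dirichlet (M t)\<close> is 0 because \<open>s < t\<close>, while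
  \<open>dirichlet n\<close> has modulus at least \<open>M s\<close>. The lower blocks cancel at
  most the subtracted sum.\<close>

lemma weak_Lp_norm_series_ge:
  fixes b :: "nat \<Rightarrow> real"
  assumes b: "\<And>u. 0 \<le> b u" and p: "0 < p"
    and n: "0 < n" "s = min_index m n" "t = max_index m n" "s < t"
    and l: "0 < l" "l < b t * M s - (\<Sum>u<t. b u * M (Suc u))"
  shows "ennreal (l * (1 / M (Suc s)) powr (1 / p))
    \<le> weak_Lp_norm (haar m) p (\<lambda>x. ennreal (cmod (mart_partial_sum m n (series (block_coeff b)) x)))"
proof -
  define a where "a = (\<lambda>i. if i = s then 1 else 0 :: nat)"
  have a: "a \<in> G" using m_ge[of s] m_pos by (auto simp: a_def vilenkin_group_def)
  have "l < cmod (\<Sum>j<n. block_coeff b j * \<psi> j x)" if x: "x \<in> cylinder m (Suc s) a" for x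
  proof -
    have xG: "x \<in> G" using x by (rule mem_cylinder_group)
    have x0: "x \<in> cylinder m s (\<lambda>_. 0)" "x s = 1" using x by (auto simp: cylinder_def a_def)
    have "x \<notin> cylinder m t (\<lambda>_. 0)" using x0(2) n(4) by (auto simp: cylinder_def)
    then have "dirichlet (M t) x = 0" by (simp add: dirichlet_gen_power[OF xG])
    moreover have "n \<le> M (Suc t)" "M t \<le> n"
      using less_gen_power_max_index[of n] gen_power_max_index_le[OF n(1)] n(3)
      by (simp_all del: gen_power.simps)
    ultimately have "(\<Sum>j<n. block_coeff b j * \<psi> j x)
        = (\<Sum>j<M t. block_coeff b j * \<psi> j x) + b t * dirichlet n x"
      by (simp add: sum_block del: gen_power.simps)
    then have "cmod (b t * dirichlet n x) \<le>
        cmod (\<Sum>j<n. block_coeff b j * \<psi> j x) + cmod (\<Sum>j<M t. block_coeff b j * \<psi> j x)"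
      using norm_triangle_ineq4[of "\<Sum>j<n. block_coeff b j * \<psi> j x" "\<Sum>j<M t. block_coeff b j * \<psi> j x"]
      by simp
    moreover have "b t * M s \<le> cmod (b t * dirichlet n x)"
      using norm_dirichlet_ge[OF x0 n(1,2)] b[of t] by (simp add: norm_mult mult_left_mono)
    moreover have "cmod (\<Sum>j<M t. block_coeff b j * \<psi> j x) \<le> (\<Sum>u<t. b u * M (Suc u))"
      using norm_sum_blocks_le[where b = b, OF b xG, of t]
      by (rule order_trans) (intro sum_mono, use b in \<open>simp add: indicator_def del: gen_power.simps\<close>)
    ultimately show ?thesis using l(2) by linarith
  qed
  then have gt: "ennreal l < ennreal (cmod (mart_partial_sum m n (series (block_coeff b)) x))"
    if "x \<in> cylinder m (Suc s) a" for x
    using that l(1) by (simp only: mart_partial_sum_series ennreal_less_iff less_imp_le)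
  have "(\<lambda>x. ennreal (cmod (mart_partial_sum m n (series (block_coeff b)) x))) \<in> borel_measurable (haar m)"
    unfolding mart_partial_sum_series by measurable
  from weak_Lp_norm_ge[OF this _ l(1) p gt] have
    "ennreal l * ennreal_powr (emeasure (haar m) (cylinder m (Suc s) a)) (1 / p)
      \<le> weak_Lp_norm (haar m) p (\<lambda>x. ennreal (cmod (mart_partial_sum m n (series (block_coeff b)) x)))"
    by (simp add: cylinder_subset space_haar)
  moreover have "ennreal l * ennreal_powr (emeasure (haar m) (cylinder m (Suc s) a)) (1 / p)
      = ennreal (l * (1 / M (Suc s)) powr (1 / p))"
    unfolding emeasure_cylinder[OF a] using l(1)
    by (simp add: ennreal_powr_def ennreal_mult' del: gen_power.simps)
  ultimately show ?thesis by simp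
qed

section \<open>The lacunary construction\<close>

lemma gen_power_Suc_le: "(\<And>k. m k \<le> L) \<Longrightarrow> real (M (Suc u)) \<le> real L * real (M u)"
  using gen_power_add_le[of L u 1] by (simp flip: of_nat_mult)

text \<open>The exponent \<open>1 / p - 1\<close> makes \<open>(b (t i) * M (t i)) powr p\<close>
  equal to \<open>M (t i) / 2 ^ i\<close>. The criterion becomes a geometric series, with
  \<open>L powr p\<close> paid for passing to \<open>M (Suc (t i))\<close>.\<close>

lemma lacunary_block_in_hardy_space:
  fixes t :: "nat \<Rightarrow> nat" and b :: "nat \<Rightarrow> real"
  assumes p: "0 < p" "p \<le> 1" and L: "\<And>k. m k \<le> L" and t: "strict_mono t"
    and b0: "\<And>u. u \<notin> range t \<Longrightarrow> b u = 0"
    and bt: "\<And>i. b (t i) = 2 powr (- real i / p) * M (t i) powr (1 / p - 1)"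
  shows "series (block_coeff b) \<in> hardy_space m p"
proof (rule series_in_hardy_space[OF _ p])
  show "0 \<le> b u" for u
    using b0[of u] bt by (cases "u \<in> range t") auto
  define g where "g u = (b u * M (Suc u)) powr p / M u" for u
  have L0: "0 < real L" using m_pos[of 0] L[of 0] by linarith
  have le: "g (t i) \<le> real L powr p * (1 / 2) ^ i" for i
  proof -
    define Mt where "Mt = real (M (t i))"
    have Mt: "0 < Mt" using gen_power_pos by (simp add: Mt_def)
    have "(b (t i) * M (Suc (t i))) powr p \<le> (b (t i) * (L * Mt)) powr p"
      using gen_power_Suc_le[of L "t i", OF L] p
      by (intro powr_mono2 mult_left_mono) (simp_all add: bt Mt_def del: gen_power.simps)
    also have "\<dots> = (2 powr (- real i / p) * Mt powr (1 / p) * L) powr p"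
      using Mt by (simp add: bt powr_diff mult.assoc flip: Mt_def)
    also have "\<dots> = 2 powr (- real i) * Mt * L powr p"
      using Mt L0 p by (simp add: powr_mult powr_powr)
    finally have "g (t i) \<le> 2 powr (- real i) * Mt * L powr p / Mt"
      unfolding g_def Mt_def using gen_power_pos[of "t i"] by (intro divide_right_mono) simp_all
    also have "\<dots> = L powr p * (1 / 2) ^ i"
      using Mt by (simp add: powr_minus powr_realpow power_one_over field_simps)
    finally show ?thesis .
  qed
  have "summable (\<lambda>i. g (t i))"
  proof (rule summable_comparison_test')
    show "summable (\<lambda>i. real L powr p * (1 / 2 :: real) ^ i)"
      by (intro summable_mult summable_geometric) simp
    show "norm (g (t i)) \<le> real L powr p * (1 / 2) ^ i" for i
      using le[of i] by (simp add: g_def)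
  qed
  then have "summable g"
    using summable_mono_reindex[OF t, of g] b0 by (simp add: g_def)
  then show "summable (\<lambda>u. (b u * M (Suc u)) powr p / M u)" by (simp only: g_def[abs_def])
qed

text \<open>The level is half of \<open>b t * M s\<close>, with \<open>s\<close> and
  \<open>t\<close> the lowest and top index of \<open>n\<close>. For the right side \<open>X\<close>
  of \<open>large\<close>, \<open>b t * M s\<close> is at least \<open>X * M s powr (1 / p)\<close>.
  So the earlier blocks stay below the level, and \<open>M s powr (1 / p)\<close> cancels against
  the measure of the cylinder, leaving at least \<open>X / (2 * L powr (1 / p))\<close>, which is at
  least \<open>i\<close>.\<close>

lemma lacunary_block_weak_norm:
  fixes b :: "nat \<Rightarrow> real" and i T :: nat
  assumes p: "0 < p" "p < 1" and L: "\<And>k. m k \<le> L" and b: "\<And>u. 0 \<le> b u"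
    and n: "0 < n" "T < max_index m n"
    and gap: "\<And>u. T < u \<Longrightarrow> u < max_index m n \<Longrightarrow> b u = 0"
    and bT: "\<And>u. u \<le> T \<Longrightarrow> b u \<le> M u powr (1 / p - 1)"
    and bn: "b (max_index m n) = 2 powr (- real i / p) * M (max_index m n) powr (1 / p - 1)"
    and spread: "0 < index_spread m n"
    and large: "2 * (\<Sum>u\<le>T. M u powr (1 / p - 1) * M (Suc u)) + 2 * real i * real L powr (1 / p) + 1
      \<le> 2 powr (- real i / p) * 2 powr (index_spread m n * (1 / p - 1))"
  shows "ennreal i
    \<le> weak_Lp_norm (haar m) p (\<lambda>x. ennreal (cmod (mart_partial_sum m n (series (block_coeff b)) x)))"
proof -
  define s where "s = min_index m n"
  define t where "t = max_index m n"
  define r where "r = index_spread m n"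
  define \<delta> where "\<delta> = 1 / p - 1"
  define X where "X = 2 powr (- real i / p) * 2 powr (r * \<delta>)"
  define S where "S = (\<Sum>u\<le>T. M u powr \<delta> * M (Suc u))"
  have \<delta>: "0 < \<delta>" using p by (simp add: \<delta>_def)
  have t: "t = s + r" "s < t" using spread by (simp_all add: s_def t_def r_def index_spread_def)
  have Ms: "1 \<le> real (M s)" using gen_power_pos[of s] by simp
  have L0: "0 < real L" using m_pos[of 0] L[of 0] by linarith
  have S0: "0 \<le> S" unfolding S_def by (intro sum_nonneg) simp
  have X: "2 * S + 2 * real i * L powr (1 / p) + 1 \<le> X"
    using large by (simp add: X_def S_def r_def \<delta>_def)
  \<comment> \<open>The summand 1 in \<open>large\<close> is what makes the first two inequalities
    strict.\<close>
  have XS: "2 * S < X" "0 < X" and Xi: "2 * real i * L powr (1 / p) \<le> X"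
  proof -
    have "0 \<le> 2 * real i * L powr (1 / p)" by simp
    with X S0 show "2 * S < X" "0 < X" "2 * real i * L powr (1 / p) \<le> X" by linarith+
  qed
  \<comment> \<open>The spread enters here: \<open>M t\<close> exceeds \<open>M s\<close> at least
    by the factor \<open>2 ^ r\<close>.\<close>
  have ge: "X * M s powr (1 / p) \<le> b t * M s"
  proof -
    have "2 ^ r * M s \<le> M t" unfolding t(1) by (rule gen_power_add_ge)
    then have "real (2 ^ r * M s) \<le> real (M t)" by (rule of_nat_mono)
    then have "(2 powr r * M s) powr \<delta> \<le> M t powr \<delta>"
      using \<delta> by (intro powr_mono2) (simp_all add: powr_realpow)
    then have "2 powr (r * \<delta>) * M s powr \<delta> \<le> M t powr \<delta>"
      by (simp add: powr_mult powr_powr)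
    then have "2 powr (- real i / p) * (2 powr (r * \<delta>) * M s powr \<delta>) * M s
        \<le> 2 powr (- real i / p) * M t powr \<delta> * M s"
      by (intro mult_right_mono mult_left_mono) simp_all
    moreover have "M s powr (1 / p) = M s powr \<delta> * M s"
      using Ms by (simp add: \<delta>_def powr_diff)
    ultimately show ?thesis using bn by (simp add: X_def t_def \<delta>_def mult.assoc)
  qed
  have "(\<Sum>u<t. b u * M (Suc u)) = (\<Sum>u\<le>T. b u * M (Suc u))"
    using gap n(2) by (intro sum.mono_neutral_right) (auto simp: t_def)
  also have "\<dots> \<le> S"
    unfolding S_def \<delta>_def using bT by (intro sum_mono mult_right_mono) auto
  also have "\<dots> < X / 2" using XS by simp
  also have "X / 2 \<le> X * M s powr (1 / p) / 2"
    using XS Ms p ge_one_powr_ge_zero[of "M s" "1 / p"] by simp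
  finally have low: "(\<Sum>u<t. b u * M (Suc u)) < b t * M s / 2" using ge by linarith
  define l where "l = b t * M s / 2"
  have "0 < X * M s powr (1 / p)" using XS Ms by simp
  then have l0: "0 < l" using ge by (simp add: l_def)
  have "real i \<le> X / (2 * L powr (1 / p))" using Xi L0 by (simp add: field_simps)
  also have "\<dots> = X * M s powr (1 / p) / 2 * (1 / (real L * real (M s))) powr (1 / p)"
    using L0 Ms by (simp add: powr_mult powr_divide)
  also have "\<dots> \<le> l * (1 / M (Suc s)) powr (1 / p)"
  proof (intro mult_mono powr_mono2)
    show "1 / (real L * real (M s)) \<le> 1 / real (M (Suc s))"
      by (intro divide_left_mono mult_pos_pos gen_power_Suc_le L)
        (use L0 gen_power_pos[of "Suc s"] gen_power_pos[of s] in \<open>simp_all del: gen_power.simps\<close>)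
  qed (use ge l0 p in \<open>simp_all add: l_def\<close>)
  finally have "ennreal i \<le> ennreal (l * (1 / M (Suc s)) powr (1 / p))" by (rule ennreal_leI)
  also have "\<dots> \<le> weak_Lp_norm (haar m) p
      (\<lambda>x. ennreal (cmod (mart_partial_sum m n (series (block_coeff b)) x)))"
  proof (rule weak_Lp_norm_series_ge[OF b p(1) n(1) s_def t_def t(2) l0])
    show "l < b t * M s - (\<Sum>u<t. b u * M (Suc u))" using low unfolding l_def by linarith
  qed
  finally show ?thesis .
qed

text \<open>The indices are chosen recursively: the previous top index fixes the bound to be beaten,
  and some \<open>\<alpha> k\<close> has a spread large enough to beat it.\<close>

lemma unbounded_weak_norms:
  assumes p: "0 < p" "p < 1" and L: "\<And>k. m k \<le> L"
    and \<alpha>: "\<And>k. 0 < \<alpha> k" "\<And>N. \<exists>k. N \<le> index_spread m (\<alpha> k)"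
  shows "\<exists>f\<in>hardy_space m p.
    (SUP k. weak_Lp_norm (haar m) p (\<lambda>x. ennreal (cmod (mart_partial_sum m (\<alpha> k) f x)))) = \<infinity>"
proof -
  define \<delta> where "\<delta> = 1 / p - 1"
  have \<delta>: "0 < \<delta>" using p by (simp add: \<delta>_def)
  define X where "X i T = 2 * (\<Sum>u\<le>T. M u powr \<delta> * M (Suc u)) + 2 * real i * real L powr (1 / p) + 1" for i T
  define t where "t k = max_index m (\<alpha> k)" for k
  define good where "good i k k' \<longleftrightarrow> t k < t k' \<and> 0 < index_spread m (\<alpha> k') \<and>
    X (Suc i) (t k) \<le> 2 powr (- real (Suc i) / p) * 2 powr (index_spread m (\<alpha> k') * \<delta>)" for i k k'
  have "\<exists>k'. good i k k'" for i k
  proof -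
    \<comment> \<open>With the weight moved to the other side, it remains to bound \<open>Y\<close>
      by 2 to the power spread times \<open>\<delta>\<close>, which a logarithm settles.\<close>
    define Y where "Y = X (Suc i) (t k) * 2 powr (real (Suc i) / p)"
    have "0 < X (Suc i) (t k)"
      unfolding X_def by (intro add_nonneg_pos add_nonneg_nonneg mult_nonneg_nonneg sum_nonneg) simp_all
    then have Y: "0 < Y" by (simp add: Y_def)
    obtain N :: nat where N: "log 2 Y / \<delta> \<le> N" using real_arch_simple by blast
    \<comment> \<open>The summand \<open>t k\<close> and the successor force
      \<open>t k < t k'\<close>, since the top index is at least the spread.\<close>
    obtain k' where k': "Suc (N + t k) \<le> index_spread m (\<alpha> k')" using \<alpha>(2) by blast
    then have "t k < t k'" "0 < index_spread m (\<alpha> k')" by (simp_all add: index_spread_def t_def)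
    moreover have "X (Suc i) (t k) \<le> 2 powr (- real (Suc i) / p) * 2 powr (index_spread m (\<alpha> k') * \<delta>)"
    proof -
      have "log 2 Y \<le> N * \<delta>" using N \<delta> by (simp add: field_simps)
      also have "\<dots> \<le> index_spread m (\<alpha> k') * \<delta>" using k' \<delta> by (intro mult_right_mono) simp_all
      finally have "Y \<le> 2 powr (index_spread m (\<alpha> k') * \<delta>)" using Y by (simp add: log_le_iff)
      then have "2 powr (- real (Suc i) / p) * Y
          \<le> 2 powr (- real (Suc i) / p) * 2 powr (index_spread m (\<alpha> k') * \<delta>)"
        by (intro mult_left_mono) simp_all
      moreover have "2 powr (- real (Suc i) / p) * 2 powr (real (Suc i) / p) = 1"
        by (simp flip: powr_add add_divide_distrib)
      ultimately show ?thesis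
        unfolding Y_def mult.left_commute[of _ "X (Suc i) (t k)"] by (simp only: mult_1_right)
    qed
    ultimately show ?thesis unfolding good_def by blast
  qed
  then obtain \<kappa> where \<kappa>: "\<And>i. good i (\<kappa> i) (\<kappa> (Suc i))"
    using dependent_nat_choice[of "\<lambda>_ _. True" good] by auto
  define \<tau> where "\<tau> i = t (\<kappa> i)" for i
  have \<tau>: "strict_mono \<tau>" using \<kappa> by (simp add: strict_mono_Suc_iff \<tau>_def good_def)
  \<comment> \<open>\<open>inv \<tau> u\<close> recovers the position of \<open>u\<close> among the
    chosen top indices, which fixes its weight.\<close>
  define b where "b u = (if u \<in> range \<tau> then 2 powr (- real (inv \<tau> u) / p) * M u powr \<delta> else 0)" for u
  have b0: "0 \<le> b u" for u by (simp add: b_def)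
  have b\<tau>: "b (\<tau> i) = 2 powr (- real i / p) * M (\<tau> i) powr \<delta>" for i
    using strict_mono_imp_inj_on[OF \<tau>] by (simp add: b_def)
  have b_le: "b u \<le> M u powr \<delta>" for u
  proof (cases "u \<in> range \<tau>")
    case True
    have "2 powr (- real (inv \<tau> u) / p) \<le> 1" using p powr_mono[of "- real (inv \<tau> u) / p" 0 2] by simp
    then show ?thesis using True mult_right_mono[of _ 1 "M u powr \<delta>"] by (simp add: b_def)
  qed (simp add: b_def)
  let ?f = "series (block_coeff b)"
  let ?w = "\<lambda>k. weak_Lp_norm (haar m) p (\<lambda>x. ennreal (cmod (mart_partial_sum m (\<alpha> k) ?f x)))"
  have "?f \<in> hardy_space m p"
    using p L \<tau> b\<tau> unfolding \<delta>_def by (intro lacunary_block_in_hardy_space) (auto simp: b_def)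
  moreover have "of_nat i \<le> (SUP k. ?w k)" for i
  proof -
    \<comment> \<open>Position 0 has no predecessor to serve as \<open>T\<close>, so the estimate
      starts at position 1.\<close>
    have "ennreal (Suc i) \<le> ?w (\<kappa> (Suc i))"
    proof (rule lacunary_block_weak_norm[where T = "\<tau> i", OF p L b0 \<alpha>(1)])
      have eq: "max_index m (\<alpha> (\<kappa> (Suc i))) = \<tau> (Suc i)" by (simp add: \<tau>_def t_def)
      show "\<tau> i < max_index m (\<alpha> (\<kappa> (Suc i)))"
        unfolding eq using \<tau> by (simp add: strict_mono_less)
      show "b u = 0" if "\<tau> i < u" "u < max_index m (\<alpha> (\<kappa> (Suc i)))" for u
        using that \<tau> unfolding eq b_def by (auto simp: strict_mono_less)
      show "b (max_index m (\<alpha> (\<kappa> (Suc i)))) =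
          2 powr (- real (Suc i) / p) * M (max_index m (\<alpha> (\<kappa> (Suc i)))) powr (1 / p - 1)"
        unfolding eq b\<tau> \<delta>_def ..
      show "b u \<le> M u powr (1 / p - 1)" for u using b_le[of u] by (simp add: \<delta>_def)
    qed (use \<kappa>[of i] in \<open>simp_all only: good_def X_def \<tau>_def \<delta>_def\<close>)
    also have "\<dots> \<le> (SUP k. ?w k)" by (rule SUP_upper) simp
    finally have "ennreal (Suc i) \<le> (SUP k. ?w k)" .
    moreover have "of_nat i \<le> ennreal (Suc i)"
      unfolding ennreal_of_nat_eq_real_of_nat by (rule ennreal_leI) simp
    ultimately show ?thesis by (rule order_trans[rotated])
  qed
  then have "(SUP i. of_nat i :: ennreal) \<le> (SUP k. ?w k)" by (intro SUP_least)
  then have "(SUP k. ?w k) = \<infinity>" by (simp add: ennreal_SUP_of_nat_eq_top top_unique)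
  ultimately show ?thesis by blast
qed

end

theorem theorem2p12:
  fixes m :: "nat \<Rightarrow> nat"
  assumes m_ge: "\<And>k. 2 \<le> m k"
    and m_bdd: "bdd_above (range m)"
  shows
    "(\<forall>(p::real) (\<alpha>::nat \<Rightarrow> nat).
        0 < p \<longrightarrow> p \<le> 1 \<longrightarrow> strict_mono \<alpha> \<longrightarrow> (\<forall>k. 0 < \<alpha> k) \<longrightarrow>
        (SUP k. enat (index_spread m (\<alpha> k))) < \<infinity> \<longrightarrow>
        bounded_hardy_Lp m p (restricted_maximal m \<alpha>))
     \<and>
     (\<forall>(p::real) (\<alpha>::nat \<Rightarrow> nat).
        0 < p \<longrightarrow> p < 1 \<longrightarrow> strict_mono \<alpha> \<longrightarrow> (\<forall>k. 0 < \<alpha> k) \<longrightarrow>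
        (SUP k. enat (index_spread m (\<alpha> k))) = \<infinity> \<longrightarrow>
        (\<exists>f\<in>hardy_space m p.
           (SUP k. weak_Lp_norm (haar m) p
              (\<lambda>x. ennreal (cmod (mart_partial_sum m (\<alpha> k) f x)))) = \<infinity>))"
proof -
  interpret vilenkin_system m by unfold_locales (rule m_ge)
  obtain L where L: "\<And>k. m k \<le> L" using m_bdd by (auto simp: bdd_above_def)
  show ?thesis
  proof (intro conjI allI impI)
    fix p :: real and \<alpha> :: "nat \<Rightarrow> nat"
    assume p: "0 < p" and \<alpha>: "\<forall>k. 0 < \<alpha> k" and "(SUP k. enat (index_spread m (\<alpha> k))) < \<infinity>"
    \<comment> \<open>A finite supremum in \<open>enat\<close> is a natural number \<open>R\<close>;
      the strict bound on the spreads is then \<open>Suc R\<close>.\<close>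
    then obtain R where R: "(SUP k. enat (index_spread m (\<alpha> k))) = enat R" by auto
    have "index_spread m (\<alpha> k) < Suc R" for k
      using SUP_upper[of k UNIV "\<lambda>k. enat (index_spread m (\<alpha> k))"] by (simp add: R)
    with p L \<alpha> show "bounded_hardy_Lp m p (restricted_maximal m \<alpha>)"
      by (intro restricted_maximal_bounded) auto
  next
    fix p :: real and \<alpha> :: "nat \<Rightarrow> nat"
    assume p: "0 < p" "p < 1" and \<alpha>: "\<forall>k. 0 < \<alpha> k"
      and inf: "(SUP k. enat (index_spread m (\<alpha> k))) = \<infinity>"
    have "\<exists>k. N \<le> index_spread m (\<alpha> k)" for N
    proof (rule ccontr)
      assume "\<nexists>k. N \<le> index_spread m (\<alpha> k)"
      then have "(SUP k. enat (index_spread m (\<alpha> k))) \<le> enat N"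
        by (intro SUP_least) (auto simp: not_le intro: less_imp_le)
      then show False by (simp add: inf)
    qed
    with p L \<alpha> show "\<exists>f\<in>hardy_space m p. (SUP k. weak_Lp_norm (haar m) p
        (\<lambda>x. ennreal (cmod (mart_partial_sum m (\<alpha> k) f x)))) = \<infinity>"
      by (intro unbounded_weak_norms) auto
  qed
qed

end
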